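(* Let $d \ge 1$ and $\nu \in A(\mathcal{E})$ for some $\mathcal{E} \subset \{1,\ldots,d\}$. Assume that $m_{\mathcal{E}}(\nu) < 0$. Then the maximal operator $\mathbb{W}_{*}^{\nu,\mathcal{E}}f=\sup_{t>0}|\mathbb{W}_t^{\nu,\mathcal{E}}f|$ is bounded from $L^1(d\eta_{\nu})$ to weak $L^{1}(d\eta_{\nu})$, that is, there is a constant $C$ such that $$\eta_\nu\big\{x\in\mathbb{R}^d_+ : \mathbb{W}_{*}^{\nu,\mathcal{E}}f(x)>\lambda\big\}\le\frac{C}{\lambda}\int_{\mathbb{R}^d_+}|f(x)|\,d\eta_\nu(x),\qquad \lambda>0,\quad f\in L^1(d\eta_\nu).$$
   Context: $\mathbb{R}^d_+=(0,\infty)^d$. For $\nu\in\mathbb{R}^d$, $\eta_\nu$ is the measure on $\mathbb{R}^d_+$ given by $d\eta_{\nu}(x) = \prod_{i=1}^d x_i^{2\nu_i+1}\,dx$. For $\mathcal{E}\subset\{1,\ldots,d\}$, with complement $\mathcal{E}^c$ in $\{1,\ldots,d\}$, let $$A(\mathcal{E})=\{\nu \in \mathbb{R}^d : 0\neq \nu_i < 1 \text{ for } i \in \mathcal{E} \text{ and } \nu_i > -1 \text{ for } i \in \mathcal{E}^c\},$$ and let $m_{\mathcal{E}}(\nu)=\max\{\nu_i: i\in\mathcal{E}\}$ if $\mathcal{E}\ne\emptyset$, $m_{\emptyset}(\nu)=-\infty$. One-dimensional classical Bessel kernel: for $a>-1$ and $u,v,t>0$, $$W_t^{a}(u,v)=\frac{1}{2t}\exp\Big(-\frac{u^2+v^2}{4t}\Big)(uv)^{-a}I_a\Big(\frac{uv}{2t}\Big),$$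 with $I_a$ the modified Bessel function of the first kind of order $a$. One-dimensional exotic Bessel kernel: for $0\ne a<1$, $$\widetilde{W}_t^{a}(u,v)=(uv)^{-2a}W_t^{-a}(u,v).$$ For $\nu\in A(\mathcal{E})$ let $$\mathbb{W}_t^{\nu,\mathcal{E}}(x,y)=\prod_{i\in\mathcal{E}}\widetilde{W}_t^{\nu_i}(x_i,y_i)\prod_{i\in\mathcal{E}^c}W_t^{\nu_i}(x_i,y_i),\qquad \mathbb{W}_t^{\nu,\mathcal{E}}f(x)=\int_{\mathbb{R}^d_+}\mathbb{W}_t^{\nu,\mathcal{E}}(x,y)f(y)\,d\eta_\nu(y),$$ for $x,y\in\mathbb{R}^d_+$, $t>0$ (empty products equal $1$); when $m_{\mathcal{E}}(\nu)<0$ the integral converges absolutely for all $f\in L^p(d\eta_\nu)$, $1\le p\le\infty$. (On $L^2(d\eta_\nu)$ this is the semigroup generated by minus a self-adjoint extension of the Bessel operator $\sum_{i=1}^d\big(-\partial_{x_i}^2-\frac{2\nu_i+1}{x_i}\partial_{x_i}\big)$.) *)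

theory Defs
  imports "HOL-Analysis.Analysis"
begin

text \<open>
  The dimension is \<open>d = CARD('n)\<close>; subsets of \<open>{1..d}\<close> become sets of type \<open>'n set\<close>.
\<close>

definition pos_orthant :: "(real ^ 'n) set" where
  "pos_orthant = {x. \<forall>i. 0 < x $ i}"

definition eta :: "real ^ 'n \<Rightarrow> (real ^ 'n) measure" where
  "eta \<nu> = density (restrict_space lborel pos_orthant)
             (\<lambda>x. ennreal (\<Prod>i\<in>UNIV. (x $ i) powr (2 * \<nu> $ i + 1)))"

definition admissible :: "'n set \<Rightarrow> (real ^ 'n) set" where
  "admissible E = {\<nu>. (\<forall>i\<in>E. \<nu> $ i \<noteq> 0 \<and> \<nu> $ i < 1) \<and> (\<forall>i\<in>-E. \<nu> $ i > -1)}"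

definition max_index :: "'n::finite set \<Rightarrow> real ^ 'n \<Rightarrow> ereal" where
  "max_index E \<nu> = (if E = {} then -\<infinity> else ereal (Max ((\<lambda>i. \<nu> $ i) ` E)))"

text \<open>
  Modified Bessel function of the first kind, of real order \<open>a\<close>, for arguments \<open>z > 0\<close>.
  The library sets \<open>Gamma\<close> to 0 at its poles, so division by it agrees with the entire
  function \<open>1 / \<Gamma>\<close> there.
\<close>

definition bessel_I :: "real \<Rightarrow> real \<Rightarrow> real" where
  "bessel_I a z = (\<Sum>k. (z / 2) powr (2 * real k + a) / (fact k * Gamma (real k + a + 1)))"

definition bessel_kernel :: "real \<Rightarrow> real \<Rightarrow> real \<Rightarrow> real \<Rightarrow> real" where
  "bessel_kernel a t u v =
     1 / (2 * t) * exp (- (u\<^sup>2 + v\<^sup>2) / (4 * t)) * (u * v) powr (- a) * bessel_I a (u * v / (2 * t))"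

definition exotic_bessel_kernel :: "real \<Rightarrow> real \<Rightarrow> real \<Rightarrow> real \<Rightarrow> real" where
  "exotic_bessel_kernel a t u v = (u * v) powr (- 2 * a) * bessel_kernel (- a) t u v"

definition mixed_kernel :: "real ^ 'n \<Rightarrow> 'n set \<Rightarrow> real \<Rightarrow> real ^ 'n \<Rightarrow> real ^ 'n \<Rightarrow> real" where
  "mixed_kernel \<nu> E t x y =
     (\<Prod>i\<in>E. exotic_bessel_kernel (\<nu> $ i) t (x $ i) (y $ i)) *
     (\<Prod>i\<in>-E. bessel_kernel (\<nu> $ i) t (x $ i) (y $ i))"

definition mixed_semigroup ::
    "real ^ 'n \<Rightarrow> 'n set \<Rightarrow> real \<Rightarrow> (real ^ 'n \<Rightarrow> complex) \<Rightarrow> real ^ 'n \<Rightarrow> complex" where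
  "mixed_semigroup \<nu> E t f x =
     (LINT y | eta \<nu>. complex_of_real (mixed_kernel \<nu> E t x y) * f y)"

text \<open>The supremum is taken in \<open>[0, \<infinity>]\<close>, as it need not be finite at every point.\<close>

definition maximal_op ::
    "real ^ 'n \<Rightarrow> 'n set \<Rightarrow> (real ^ 'n \<Rightarrow> complex) \<Rightarrow> real ^ 'n \<Rightarrow> ennreal" where
  "maximal_op \<nu> E f x = (SUP t\<in>{0<..}. ennreal (cmod (mixed_semigroup \<nu> E t f x)))"

end

theory Submission
  imports Defs
begin

text \<open>
  For each exotic coordinate put \<open>a = - \<nu>\<^sub>i > 0\<close>.  The exotic kernel is then the classical kernel of
  order \<open>a\<close>, twisted by \<open>(u v)\<^sup>c\<close> with \<open>c = 2 a\<close>, and the twist is exactly compensated by the weight: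
  \<open>2 \<nu>\<^sub>i + 1 = 2 a + 1 - 2 c\<close>.  Hence exotic and classical factors can be treated together, as
  kernels \<open>(u v)\<^sup>c W\<^sub>t\<^sup>a(u, v)\<close> with \<open>a > -1\<close> and \<open>c = 0\<close> or \<open>c = 2 a > 0\<close>.

  Since some \<open>\<nu>\<^sub>i\<close> may be \<open>\<le> -1\<close>, the measure need not be finite near the boundary of the orthant,
  and covering arguments for doubling measures do not apply directly.  The proof goes through ergodic theory
  instead, and rests on two properties of the product kernel.

  First, it is the kernel of a symmetric sub-Markovian semigroup.  For one coordinate the semigroup
  law is Weber's integral, which after expanding both Bessel functions reduces to the
  Chu--Vandermonde identity (\<open>bessel_kernel_semigroup\<close>).  The total mass is \<open>1\<close> in the classical case
  and a normalised incomplete Gamma function, hence at most \<open>1\<close>, in the exotic case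
  (\<open>twisted_kernel_mass\<close>); probabilistically the exotic kernel belongs to a Bessel process killed at
  the origin.  Both properties pass to products because the measure is a product.

  Secondly, it is almost increasing in time on a scale of factor four: \<open>K\<^sub>t \<le> C K\<^sub>s\<close> for
  \<open>t \<le> s \<le> 4 t\<close> (\<open>mixed_kernel_compare\<close>).  This comes from the fact that \<open>exp (-z) z\<^sup>-\<^sup>a I\<^sub>a(z)\<close> is
  decreasing in \<open>z\<close> when \<open>a \<ge> 0\<close>, and a three-term recurrence that reduces the orders
  \<open>-1 < a < 0\<close> to nonnegative ones.

  Fix a small step \<open>\<delta>\<close> and let \<open>T\<close> be the operator at time \<open>\<delta>\<close>.  For \<open>t \<ge> \<delta>\<close> and nonnegative \<open>g\<close>, time
  comparison bounds the operator at time \<open>t\<close> by each power \<open>T\<^sup>n\<close> with \<open>t \<le> n \<delta> \<le> 4 t\<close>, hence by a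
  constant times an ergodic average of \<open>T\<close>.  Hopf's maximal ergodic inequality
  (\<open>maximal_ergodic_inequality\<close>) bounds the maximal average in weak \<open>L\<^sup>1\<close> with a constant that does not
  depend on \<open>\<delta>\<close>, so \<open>\<delta>\<close> can tend to \<open>0\<close>.  Measurability of the level sets follows from
  continuity in \<open>t\<close>, which allows the supremum to be taken over rational times.
\<close>

section \<open>The normalised Bessel series\<close>

definition bessel_coeff :: "real \<Rightarrow> nat \<Rightarrow> real" where
  "bessel_coeff a k = 1 / (fact k * Gamma (real k + a + 1))"

text \<open>
  This is the entire function in \<open>I\<^sub>a(z) = (z/2)\<^sup>a \<Sum>\<^sub>k (z\<^sup>2/4)\<^sup>k / (k! \<Gamma>(k + a + 1))\<close>.  Its argument is \<open>z\<^sup>2/4\<close>, so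
  that it is an honest power series and differentiation merely raises the order by one.
\<close>

definition bessel_series :: "real \<Rightarrow> real \<Rightarrow> real" where
  "bessel_series a q = (\<Sum>k. bessel_coeff a k * q ^ k)"

lemma bessel_coeff_pos: "a > -1 \<Longrightarrow> 0 < bessel_coeff a k"
  unfolding bessel_coeff_def by (intro divide_pos_pos mult_pos_pos Gamma_real_pos) auto

lemma Gamma_plus1_pos: "x > 0 \<Longrightarrow> Gamma (x + 1) = x * Gamma (x::real)"
  by (rule Gamma_plus1) (auto elim!: nonpos_Ints_cases)

lemma bessel_coeff_Suc:
  assumes "a > -1"
  shows "bessel_coeff a (Suc k) = bessel_coeff a k / ((real k + 1) * (real k + a + 1))"
  using Gamma_plus1_pos[of "real k + a + 1"] assms
  by (simp add: bessel_coeff_def add_ac field_simps)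

lemma bessel_coeff_shift:
  assumes "a > -1"
  shows "bessel_coeff a k = (real k + a + 1) * bessel_coeff (a + 1) k"
proof -
  define r where "r = real k + a + 1"
  have r: "r > 0" "real k + (a + 1) + 1 = r + 1" using assms by (auto simp: r_def)
  show ?thesis
    unfolding bessel_coeff_def r_def[symmetric] r(2) Gamma_plus1_pos[OF r(1)] using r(1) by simp
qed

lemma bessel_coeff_Suc_shift:
  "(real k + 1) * bessel_coeff a (Suc k) = bessel_coeff (a + 1) k"
proof -
  have e: "real (Suc k) + a + 1 = real k + (a + 1) + 1" by simp
  have "fact (Suc k) = (real k + 1) * fact k" by simp
  then show ?thesis unfolding bessel_coeff_def e by (simp del: fact_Suc)
qed

lemma summable_bessel_series:
  assumes "a > -1"
  shows "summable (\<lambda>k. bessel_coeff a k * q ^ k)"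
proof (rule summable_ratio_test[of "1/2" "nat \<lceil>2 * \<bar>q\<bar>\<rceil> + 1"])
  fix n assume n: "nat \<lceil>2 * \<bar>q\<bar>\<rceil> + 1 \<le> n"
  have q: "2 * \<bar>q\<bar> \<le> real n" using n by linarith
  have n1: "real n \<ge> 1" using n by linarith
  have "(real n + 1) * 1 \<le> (real n + 1) * (real n + a + 1)"
    using n1 assms by (intro mult_left_mono) auto
  then have le: "\<bar>q\<bar> / ((real n + 1) * (real n + a + 1)) \<le> 1/2"
    using q n1 assms by (simp add: field_simps)
  have "norm (bessel_coeff a (Suc n) * q ^ Suc n)
      = (\<bar>q\<bar> / ((real n + 1) * (real n + a + 1))) * norm (bessel_coeff a n * q ^ n)"
  proof -
    have "0 < (real n + 1) * (real n + a + 1)" using n1 assms by (intro mult_pos_pos) auto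
    then have "\<bar>(real n + 1) * (real n + a + 1)\<bar> = (real n + 1) * (real n + a + 1)" by simp
    then show ?thesis
      by (simp add: bessel_coeff_Suc[OF assms] norm_mult norm_divide abs_mult abs_divide power_abs del: distrib_left distrib_right)
  qed
  also have "\<dots> \<le> 1/2 * norm (bessel_coeff a n * q ^ n)"
    using le by (rule mult_right_mono) simp
  finally show "norm (bessel_coeff a (Suc n) * q ^ Suc n) \<le> 1/2 * norm (bessel_coeff a n * q ^ n)" .
qed simp

lemma sums_bessel_series: "a > -1 \<Longrightarrow> (\<lambda>k. bessel_coeff a k * q ^ k) sums bessel_series a q"
  unfolding bessel_series_def by (rule summable_sums[OF summable_bessel_series])

lemma bessel_series_has_derivative:
  assumes "a > -1"
  shows "(bessel_series a has_field_derivative bessel_series (a + 1) q) (at q)"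
proof -
  have "diffs (bessel_coeff a) = bessel_coeff (a + 1)"
    using bessel_coeff_Suc_shift[of _ a] by (auto simp: diffs_def fun_eq_iff add.commute)
  then show ?thesis
    using termdiffs_strong_converges_everywhere[of "bessel_coeff a" q] summable_bessel_series[OF assms]
    unfolding bessel_series_def[abs_def] by simp
qed

lemma continuous_bessel_series: "a > -1 \<Longrightarrow> continuous_on S (bessel_series a)"
  by (meson DERIV_isCont bessel_series_has_derivative continuous_at_imp_continuous_on)

lemma bessel_series_pos:
  assumes "a > -1" "q \<ge> 0"
  shows "bessel_series a q > 0"
  unfolding bessel_series_def
  by (rule suminf_pos2[of _ 0]) (use assms in \<open>auto intro!: summable_bessel_series mult_nonneg_nonneg simp: bessel_coeff_pos less_imp_le\<close>)

lemma bessel_series_recurrence: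
  assumes "a > -1"
  shows "bessel_series a q = (a + 1) * bessel_series (a + 1) q + q * bessel_series (a + 2) q"
proof -
  have s2: "(\<lambda>k. bessel_coeff (a + 2) k * q ^ k) sums bessel_series (a + 2) q"
    using assms by (intro sums_bessel_series) simp
  have "(\<lambda>k. real (Suc k) * bessel_coeff (a + 1) (Suc k) * q ^ Suc k) sums (q * bessel_series (a + 2) q)"
    using sums_mult[OF s2, of q] bessel_coeff_Suc_shift[of _ "a + 1"]
    by (simp add: mult_ac add_ac)
  then have "(\<lambda>k. real k * bessel_coeff (a + 1) k * q ^ k) sums (q * bessel_series (a + 2) q)"
    by (subst (asm) sums_Suc_iff) simp
  moreover have "(\<lambda>k. (a + 1) * (bessel_coeff (a + 1) k * q ^ k)) sums ((a + 1) * bessel_series (a + 1) q)"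
    using assms by (intro sums_mult sums_bessel_series) simp
  ultimately have "(\<lambda>k. (a + 1) * (bessel_coeff (a + 1) k * q ^ k) + real k * bessel_coeff (a + 1) k * q ^ k)
      sums ((a + 1) * bessel_series (a + 1) q + q * bessel_series (a + 2) q)"
    by (intro sums_add)
  moreover have "(\<lambda>k. (a + 1) * (bessel_coeff (a + 1) k * q ^ k) + real k * bessel_coeff (a + 1) k * q ^ k)
     = (\<lambda>k. bessel_coeff a k * q ^ k)"
    by (subst bessel_coeff_shift[OF assms]) (simp add: algebra_simps)
  ultimately show ?thesis
    using sums_bessel_series[OF assms, of q] sums_unique2 by metis
qed

text \<open>
  Weight the arithmetic-geometric mean inequality in the \<open>k\<close>-th term:
  \<open>2 w \<le> r + w\<^sup>2 / r\<close> with \<open>r = k + a + 1\<close>.  The first half of the bound reproduces the \<open>k\<close>-th term of the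
  series of order \<open>a\<close>.  The second half is a multiple of the next term, with factor
  \<open>(k + 1) / (k + 1 + a) \<le> 1\<close>.  In terms of Bessel functions this is \<open>I\<^sub>a\<^sub>+\<^sub>1 \<le> I\<^sub>a\<close>.
\<close>

lemma bessel_series_shift_le:
  assumes a: "a \<ge> 0" and w: "w \<ge> 0"
  shows "w * bessel_series (a + 1) (w\<^sup>2) \<le> bessel_series a (w\<^sup>2)"
proof -
  let ?c = "\<lambda>k. bessel_coeff (a + 1) k"
  have s0: "(\<lambda>k. bessel_coeff a k * (w\<^sup>2) ^ k) sums bessel_series a (w\<^sup>2)"
    using a by (intro sums_bessel_series) simp
  have s1: "(\<lambda>k. ?c k * (w\<^sup>2) ^ k) sums bessel_series (a + 1) (w\<^sup>2)"
    using a by (intro sums_bessel_series) simp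
  let ?t = "\<lambda>k. real k / (real k + a) * (bessel_coeff a k * (w\<^sup>2) ^ k)"
  have t: "0 \<le> ?t k" "?t k \<le> bessel_coeff a k * (w\<^sup>2) ^ k" for k
  proof -
    have r: "0 \<le> real k / (real k + a)" "real k / (real k + a) \<le> 1"
      using a by (auto simp: divide_le_eq)
    have c: "0 \<le> bessel_coeff a k * (w\<^sup>2) ^ k" using bessel_coeff_pos[of a k] a by simp
    show "0 \<le> ?t k" using r(1) c by (rule mult_nonneg_nonneg)
    show "?t k \<le> bessel_coeff a k * (w\<^sup>2) ^ k" using c r by (rule mult_left_le_one_le)
  qed
  have s2: "summable ?t"
    by (rule summable_comparison_test'[OF sums_summable[OF s0], of 0])
       (use t in \<open>simp only: real_norm_def abs_of_nonneg\<close>)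
  let ?S = "suminf ?t"
  have S_le: "?S \<le> bessel_series a (w\<^sup>2)"
    unfolding bessel_series_def by (rule suminf_le[OF t(2) s2 sums_summable[OF s0]])
  have "(\<lambda>k. real (Suc k) / (real (Suc k) + a) * (bessel_coeff a (Suc k) * (w\<^sup>2) ^ Suc k)) sums ?S"
    using summable_sums[OF s2] by (subst sums_Suc_iff) simp
  moreover have "?t (Suc k) = ?c k / (real k + 1 + a) * (w\<^sup>2) ^ Suc k" for k
    by (subst bessel_coeff_Suc_shift[symmetric]) (simp add: mult_ac add_ac)
  ultimately have s3: "(\<lambda>k. ?c k / (real k + 1 + a) * (w\<^sup>2) ^ Suc k) sums ?S"
    by (simp only:)
  have s4: "(\<lambda>k. 1/2 * (bessel_coeff a k * (w\<^sup>2) ^ k + ?c k / (real k + 1 + a) * (w\<^sup>2) ^ Suc k))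
      sums (1/2 * (bessel_series a (w\<^sup>2) + ?S))"
    by (intro sums_mult sums_add s0 s3)
  have "w * bessel_series (a + 1) (w\<^sup>2) \<le> 1/2 * (bessel_series a (w\<^sup>2) + ?S)"
  proof (rule sums_le[OF _ sums_mult[OF s1] s4])
    fix k
    define r where "r = real k + a + 1"
    have r: "r > 0" using a by (simp add: r_def)
    have ca: "bessel_coeff a k = r * ?c k" using bessel_coeff_shift[of a k] a by (simp add: r_def)
    have "w \<le> 1/2 * (r + w\<^sup>2 / r)"
    proof -
      have "0 \<le> (r - w)\<^sup>2" by simp
      then have "2 * (w * r) \<le> r\<^sup>2 + w\<^sup>2" by (simp add: power2_eq_square algebra_simps)
      then show ?thesis using r by (simp add: field_simps power2_eq_square)
    qed
    then have "w * (?c k * (w\<^sup>2) ^ k) \<le> 1/2 * (r + w\<^sup>2 / r) * (?c k * (w\<^sup>2) ^ k)"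
      using bessel_coeff_pos[of "a + 1" k] a by (intro mult_right_mono) auto
    also have "\<dots> = 1/2 * (bessel_coeff a k * (w\<^sup>2) ^ k + ?c k / (real k + 1 + a) * (w\<^sup>2) ^ Suc k)"
      unfolding ca by (simp add: r_def algebra_simps)
    finally show "w * (?c k * (w\<^sup>2) ^ k) \<le> \<dots>" .
  qed
  with S_le show ?thesis by simp
qed

text \<open>
  With \<open>w = z/2\<close> this is \<open>exp (-z) I\<^sub>a(z) (z/2)\<^sup>-\<^sup>a\<close>: the exponential compensates the growth of the Bessel
  function.
\<close>

definition damped_series :: "real \<Rightarrow> real \<Rightarrow> real" where
  "damped_series a w = exp (- 2 * w) * bessel_series a (w\<^sup>2)"

lemma damped_series_pos: "a > -1 \<Longrightarrow> damped_series a w > 0"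
  unfolding damped_series_def by (simp add: bessel_series_pos)

text \<open>
  The derivative is \<open>2 exp (-2w)\<close> times the difference of the two sides of
  \<open>bessel_series_shift_le\<close>.
\<close>

lemma damped_series_antimono:
  assumes a: "a \<ge> 0" and w: "0 \<le> w'" "w' \<le> w"
  shows "damped_series a w \<le> damped_series a w'"
proof (rule DERIV_nonpos_imp_nonincreasing[OF w(2)])
  fix x assume x: "w' \<le> x" "x \<le> w"
  have "(damped_series a has_field_derivative
      exp (- 2 * x) * (2 * x * bessel_series (a + 1) (x\<^sup>2)) - 2 * exp (- 2 * x) * bessel_series a (x\<^sup>2)) (at x)"
    unfolding damped_series_def[abs_def] using a
    by (auto intro!: derivative_eq_intros DERIV_chain2[OF bessel_series_has_derivative] simp: mult_ac)
  moreover have "exp (- 2 * x) * (2 * x * bessel_series (a + 1) (x\<^sup>2)) - 2 * exp (- 2 * x) * bessel_series a (x\<^sup>2) \<le> 0"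
    using bessel_series_shift_le[OF a, of x] x w by (simp add: algebra_simps)
  ultimately show "\<exists>y. (damped_series a has_real_derivative y) (at x) \<and> y \<le> 0" by blast
qed

lemma damped_series_recurrence:
  "a > -1 \<Longrightarrow> damped_series a w = (a + 1) * damped_series (a + 1) w + w\<^sup>2 * damped_series (a + 2) w"
  unfolding damped_series_def using bessel_series_recurrence[of a "w\<^sup>2"] by (simp add: algebra_simps)

text \<open>
  Monotonicity is available only for orders \<open>\<ge> 0\<close>, but the recurrence writes the damped series of order
  \<open>a\<close> with nonnegative coefficients \<open>a + 1\<close> and \<open>w\<^sup>2\<close> in terms of the two decreasing ones of orders
  \<open>a + 1\<close> and \<open>a + 2\<close>; only the factor \<open>w\<^sup>2 \<le> 16 w'\<^sup>2\<close> is lost.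
\<close>

lemma damped_series_compare:
  assumes a: "a > -1" and w: "0 \<le> w'" "w' \<le> w" "w \<le> 4 * w'"
  shows "damped_series a w \<le> 16 * damped_series a w'"
proof -
  have "w\<^sup>2 \<le> (4 * w')\<^sup>2" using w by (intro power_mono) auto
  then have w2: "w\<^sup>2 \<le> 16 * w'\<^sup>2" by (simp add: power2_eq_square)
  have "damped_series a w = (a + 1) * damped_series (a + 1) w + w\<^sup>2 * damped_series (a + 2) w"
    using a by (rule damped_series_recurrence)
  also have "\<dots> \<le> (a + 1) * (16 * damped_series (a + 1) w') + 16 * w'\<^sup>2 * damped_series (a + 2) w'"
  proof (intro add_mono mult_left_mono mult_mono w2)
    show "damped_series (a + 1) w \<le> 16 * damped_series (a + 1) w'"
      using damped_series_antimono[of "a + 1" w' w] damped_series_pos[of "a + 1" w'] a w by simp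
  qed (use damped_series_antimono[of "a + 2" w' w] damped_series_pos[of "a + 2" w] a w in auto)
  also have "\<dots> = 16 * damped_series a w'"
    using damped_series_recurrence[OF a, of w'] by simp
  finally show ?thesis .
qed

lemma damped_series_bound:
  assumes a: "a > -1" and w: "0 \<le> w"
  shows "damped_series a w \<le> (a + 1) * damped_series (a + 1) 0 + w\<^sup>2 * damped_series (a + 2) 0"
  unfolding damped_series_recurrence[OF a]
  using damped_series_antimono[of "a + 1" 0 w] damped_series_antimono[of "a + 2" 0 w] a w
  by (intro add_mono mult_left_mono) auto

section \<open>Bessel kernels on the half-line\<close>

text \<open>
  With \<open>c = 0\<close> this is the classical kernel of order \<open>a\<close>; with \<open>c = 2 a\<close> it is the exotic kernel of
  parameter \<open>- a\<close>.  The reference measure that goes with it is \<open>v powr (2 a + 1 - 2 c) dv\<close>.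
\<close>

definition twisted_kernel :: "real \<Rightarrow> real \<Rightarrow> real \<Rightarrow> real \<Rightarrow> real \<Rightarrow> real" where
  "twisted_kernel c a t u v = (u * v) powr c * bessel_kernel a t u v"

lemma bessel_I_eq_series:
  assumes "a > -1" "z > 0"
  shows "bessel_I a z = (z / 2) powr a * bessel_series a ((z / 2)\<^sup>2)"
proof -
  have "(z / 2) powr (2 * real k + a) / (fact k * Gamma (real k + a + 1))
      = (z / 2) powr a * (bessel_coeff a k * ((z / 2)\<^sup>2) ^ k)" for k
    using assms powr_realpow[of "z/2" "2 * k"]
    by (simp add: powr_add bessel_coeff_def power_mult)
  then show ?thesis
    unfolding bessel_I_def bessel_series_def using suminf_mult[OF summable_bessel_series[OF assms(1)]] by simp
qed

lemma bessel_kernel_eq_series: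
  assumes "a > -1" "t > 0" "u > 0" "v > 0"
  defines "p \<equiv> 1 / (4 * t)"
  shows "bessel_kernel a t u v = 2 * p powr (a + 1) * exp (- p * (u\<^sup>2 + v\<^sup>2)) * bessel_series a ((p * u * v)\<^sup>2)"
proof -
  have p: "p > 0" using assms by (simp add: p_def)
  have z: "u * v / (2 * t) / 2 = p * u * v" "u * v / (2 * t) > 0"
    using assms by (auto simp: p_def)
  have "(u * v) powr (- a) * (p * u * v) powr a = p powr a"
    using assms(3,4) p by (simp add: powr_mult powr_minus field_simps)
  moreover have "1 / (2 * t) = 2 * p" "p powr (a + 1) = p powr a * p"
    using p by (auto simp: p_def powr_add)
  moreover have "- (u\<^sup>2 + v\<^sup>2) / (4 * t) = - p * (u\<^sup>2 + v\<^sup>2)"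
    using assms(2) by (simp add: p_def field_simps)
  ultimately show ?thesis
    unfolding bessel_kernel_def bessel_I_eq_series[OF assms(1) z(2)] z(1)
    by (simp only: mult_ac) (simp add: mult_ac)
qed

lemma bessel_kernel_eq_damped_series:
  assumes "a > -1" "t > 0" "u > 0" "v > 0"
  defines "p \<equiv> 1 / (4 * t)"
  shows "bessel_kernel a t u v = 2 * p powr (a + 1) * exp (- p * (u - v)\<^sup>2) * damped_series a (p * u * v)"
proof -
  have "exp (- p * (u\<^sup>2 + v\<^sup>2)) = exp (- p * (u - v)\<^sup>2) * exp (- 2 * (p * u * v))"
    unfolding exp_add[symmetric] by (simp add: power2_eq_square algebra_simps)
  then show ?thesis
    using bessel_kernel_eq_series[OF assms(1-4)] by (simp add: p_def damped_series_def)
qed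

lemma bessel_kernel_commute: "bessel_kernel a t u v = bessel_kernel a t v u"
  by (simp add: bessel_kernel_def mult.commute add.commute)

lemma twisted_kernel_commute: "twisted_kernel c a t u v = twisted_kernel c a t v u"
  by (simp add: twisted_kernel_def bessel_kernel_commute[of a t u v] mult.commute)

lemma bessel_kernel_pos:
  assumes "a > -1" "t > 0" "u > 0" "v > 0"
  shows "bessel_kernel a t u v > 0"
  unfolding bessel_kernel_eq_series[OF assms] using assms by (auto intro!: mult_pos_pos bessel_series_pos)

lemma twisted_kernel_pos:
  assumes "a > -1" "t > 0" "u > 0" "v > 0"
  shows "twisted_kernel c a t u v > 0"
  unfolding twisted_kernel_def using bessel_kernel_pos[OF assms] assms by simp

text \<open>
  Completing the square in the exponent separates a Gaussian in \<open>u - v\<close>, which increases with time, from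
  a damped series at \<open>u v / (4 t)\<close>, which is almost increasing in time by \<open>damped_series_compare\<close>.  The
  remaining power of \<open>t\<close> changes by at most \<open>4 powr (a + 1)\<close>.
\<close>

lemma bessel_kernel_compare:
  assumes a: "a > -1" and t: "t > 0" and s: "t \<le> s" "s \<le> 4 * t" and uv: "u > 0" "v > 0"
  shows "bessel_kernel a t u v \<le> 16 * 4 powr (a + 1) * bessel_kernel a s u v"
proof -
  define p q where "p = 1 / (4 * t)" and "q = 1 / (4 * s)"
  have s0: "s > 0" using t s by simp
  have pq: "0 < p" "0 < q" "q \<le> p" "p \<le> 4 * q"
    using t s s0 by (auto simp: p_def q_def field_simps)
  have pa: "p powr (a + 1) \<le> 4 powr (a + 1) * q powr (a + 1)"
    using pq a powr_mono2[of "a + 1" p "4 * q"] by (simp add: powr_mult)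
  have ex: "exp (- p * (u - v)\<^sup>2) \<le> exp (- q * (u - v)\<^sup>2)"
    using pq by (simp add: mult_right_mono)
  have da: "damped_series a (p * u * v) \<le> 16 * damped_series a (q * u * v)"
    using pq uv by (intro damped_series_compare[OF a]) (auto intro!: mult_right_mono)
  have "bessel_kernel a t u v = 2 * (p powr (a + 1) * (exp (- p * (u - v)\<^sup>2) * damped_series a (p * u * v)))"
    using bessel_kernel_eq_damped_series[OF a t uv] by (simp add: p_def mult_ac)
  also have "\<dots> \<le> 2 * (4 powr (a + 1) * q powr (a + 1) * (exp (- q * (u - v)\<^sup>2) * (16 * damped_series a (q * u * v))))"
    using damped_series_pos[OF a] by (intro mult_left_mono mult_mono pa ex da) (auto simp: less_imp_le)
  also have "\<dots> = 16 * 4 powr (a + 1) * bessel_kernel a s u v"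
    using bessel_kernel_eq_damped_series[OF a s0 uv] by (simp add: q_def mult_ac)
  finally show ?thesis .
qed

lemma twisted_kernel_compare:
  assumes "a > -1" "t > 0" "t \<le> s" "s \<le> 4 * t" "u > 0" "v > 0"
  shows "twisted_kernel c a t u v \<le> 16 * 4 powr (a + 1) * twisted_kernel c a s u v"
  unfolding twisted_kernel_def
  using mult_left_mono[OF bessel_kernel_compare[OF assms], of "(u * v) powr c"] by (simp add: mult_ac)

lemma continuous_on_twisted_kernel_time:
  assumes "a > -1" "u > 0" "v > 0"
  shows "continuous_on {0<..} (\<lambda>t. twisted_kernel c a t u v)"
proof -
  have "continuous_on {0<..} (\<lambda>t. (u * v) powr c * (2 * (1 / (4 * t)) powr (a + 1) *
      exp (- (1 / (4 * t)) * (u\<^sup>2 + v\<^sup>2)) * bessel_series a ((1 / (4 * t) * u * v)\<^sup>2)))"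
    by (intro continuous_intros continuous_on_compose2[OF continuous_bessel_series[OF assms(1), of UNIV]]) auto
  then show ?thesis
    by (rule continuous_on_eq)
       (use bessel_kernel_eq_series[OF assms(1) _ assms(2,3)] in \<open>simp add: twisted_kernel_def\<close>)
qed

text \<open>
  For fixed \<open>u\<close> all other factors grow at most exponentially in \<open>v\<close>, so the Gaussian wins; completing the
  square gives an explicit bound.
\<close>

lemma twisted_kernel_bounded:
  assumes a: "a > -1" and c: "c \<ge> 0" and t: "t > 0" and u: "u > 0"
  shows "\<exists>B. \<forall>v>0. twisted_kernel c a t u v \<le> B"
proof -
  define p where "p = 1 / (4 * t)"
  have p: "p > 0" using t by (simp add: p_def)
  define A where "A = (a + 1) * damped_series (a + 1) 0 + 2 * damped_series (a + 2) 0"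
  have A: "A \<ge> 0"
    using damped_series_pos[of "a + 1" 0] damped_series_pos[of "a + 2" 0] a by (auto simp: A_def)
  define m where "m = c * u + 3 * p * u"
  have "twisted_kernel c a t u v \<le> 2 * p powr (a + 1) * A * exp (m\<^sup>2 / (4 * p))" if v: "v > 0" for v
  proof -
    define z where "z = p * u * v"
    have z: "z \<ge> 0" using p u v by (simp add: z_def)
    have "z\<^sup>2 / 2 \<le> exp z" using exp_lower_Taylor_quadratic[OF z] z by simp
    moreover have "1 \<le> exp z" using z by simp
    ultimately have "(a + 1) * damped_series (a + 1) 0 * 1 + damped_series (a + 2) 0 * 2 * (z\<^sup>2 / 2)
       \<le> (a + 1) * damped_series (a + 1) 0 * exp z + damped_series (a + 2) 0 * 2 * exp z"
      using a damped_series_pos[of "a + 1" 0] damped_series_pos[of "a + 2" 0]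
      by (intro add_mono mult_left_mono) auto
    then have da: "damped_series a z \<le> A * exp z"
      using damped_series_bound[OF a z] by (simp add: A_def algebra_simps)
    have "u * v \<le> exp (u * v)" using exp_ge_add_one_self[of "u * v"] by linarith
    then have po: "(u * v) powr c \<le> exp (c * (u * v))"
      using powr_mono2[OF c, of "u * v" "exp (u * v)"] u v by (simp add: powr_def)
    \<comment> \<open>the square completing \<open>p v\<^sup>2 - m v\<close>, where \<open>m\<close> collects all linear terms of the exponent\<close>
    have "0 \<le> (2 * p * v - m)\<^sup>2 / (4 * p)" using p by simp
    also have "\<dots> = p * v\<^sup>2 - m * v + m\<^sup>2 / (4 * p)"
      using p by (simp add: power2_eq_square field_simps)
    finally have ex: "c * (u * v) - p * (u - v)\<^sup>2 + z \<le> m\<^sup>2 / (4 * p)"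
      using p by (simp add: m_def z_def power2_eq_square algebra_simps) (smt (verit) mult_nonneg_nonneg zero_le_square)
    have "twisted_kernel c a t u v = 2 * p powr (a + 1) * ((u * v) powr c * (exp (- p * (u - v)\<^sup>2) * damped_series a z))"
      unfolding twisted_kernel_def using bessel_kernel_eq_damped_series[OF a t u v]
      by (simp add: p_def z_def mult_ac)
    also have "\<dots> \<le> 2 * p powr (a + 1) * (exp (c * (u * v)) * (exp (- p * (u - v)\<^sup>2) * (A * exp z)))"
      using p damped_series_pos[OF a, of z] by (intro mult_left_mono mult_mono da po) auto
    also have "\<dots> = 2 * p powr (a + 1) * A * exp (c * (u * v) - p * (u - v)\<^sup>2 + z)"
      by (simp add: exp_add exp_diff exp_minus field_simps)
    also have "\<dots> \<le> 2 * p powr (a + 1) * A * exp (m\<^sup>2 / (4 * p))"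
      using ex A by (intro mult_left_mono) auto
    finally show ?thesis .
  qed
  then show ?thesis by blast
qed

lemma measurable_bessel_I [measurable]: "bessel_I a \<in> borel_measurable borel"
  unfolding bessel_I_def[abs_def] by measurable

lemma measurable_twisted_kernel [measurable (raw)]:
  assumes [measurable]: "f \<in> borel_measurable M" "g \<in> borel_measurable M"
  shows "(\<lambda>x. twisted_kernel c a t (f x) (g x)) \<in> borel_measurable M"
  unfolding twisted_kernel_def bessel_kernel_def by measurable

text \<open>
  The substitution \<open>x = P v\<^sup>2\<close> in the Gamma integral, on \<open>[0, n]\<close> and then with \<open>n\<close> tending to infinity.
\<close>

lemma nn_integral_powr_gaussian:
  assumes P: "P > 0" and c: "c > 0"
  shows "(\<integral>\<^sup>+v\<in>{0<..}. ennreal (v powr (2 * c - 1) * exp (- P * v\<^sup>2)) \<partial>lborel)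
    = ennreal (Gamma c / (2 * P powr c))"
proof -
  let ?f = "\<lambda>x. x powr (c - 1) / exp x :: real"
  let ?h = "\<lambda>v. ?f (P * v\<^sup>2) * (2 * P * v)"
  have sub: "(\<integral>\<^sup>+x. ennreal (?f x * indicator {0..P * (real n)\<^sup>2} x) \<partial>lborel)
      = (\<integral>\<^sup>+v. ennreal (?h v * indicator {0..real n} v) \<partial>lborel)" for n :: nat
  proof -
    have "(\<integral>\<^sup>+x. ennreal (?f x * indicator {P * 0\<^sup>2..P * (real n)\<^sup>2} x) \<partial>lborel)
      = (\<integral>\<^sup>+v. ennreal (?h v * indicator {0..real n} v) \<partial>lborel)"
      by (rule nn_integral_substitution[where g = "\<lambda>v. P * v\<^sup>2" and g' = "\<lambda>v. 2 * P * v"])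
         (use P in \<open>auto simp: set_borel_measurable_def intro!: derivative_eq_intros continuous_intros\<close>)
    then show ?thesis by simp
  qed
  have "(\<integral>\<^sup>+x. (SUP n. ennreal (?f x * indicator {0..P * (real n)\<^sup>2} x)) \<partial>lborel)
     = (SUP n. (\<integral>\<^sup>+x. ennreal (?f x * indicator {0..P * (real n)\<^sup>2} x) \<partial>lborel))"
  proof (rule nn_integral_monotone_convergence_SUP)
    show "incseq (\<lambda>n x. ennreal (?f x * indicator {0..P * (real n)\<^sup>2} x))"
    proof (intro incseq_SucI le_funI ennreal_leI mult_left_mono)
      fix n x
      have "P * (real n)\<^sup>2 \<le> P * (real (Suc n))\<^sup>2"
        using P by (intro mult_left_mono power_mono) auto
      then show "indicator {0..P * (real n)\<^sup>2} x \<le> (indicator {0..P * (real (Suc n))\<^sup>2} x :: real)"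
        by (auto simp: indicator_def simp del: of_nat_Suc)
    qed simp
  qed measurable
  also have "\<dots> = (SUP n. (\<integral>\<^sup>+v. ennreal (?h v * indicator {0..real n} v) \<partial>lborel))"
    unfolding sub ..
  also have "\<dots> = (\<integral>\<^sup>+v. (SUP n. ennreal (?h v * indicator {0..real n} v)) \<partial>lborel)"
  proof (rule nn_integral_monotone_convergence_SUP[symmetric])
    show "incseq (\<lambda>n v. ennreal (?h v * indicator {0..real n} v))"
      using P by (intro incseq_SucI le_funI ennreal_leI) (auto simp: indicator_def)
  qed measurable
  also have "(\<lambda>v. SUP n. ennreal (?h v * indicator {0..real n} v)) = (\<lambda>v. ennreal (?h v * indicator {0..} v))"
  proof
    fix v :: real
    obtain n where n: "v \<le> real n" using real_arch_simple by blast
    show "(SUP n. ennreal (?h v * indicator {0..real n} v)) = ennreal (?h v * indicator {0..} v)"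
    proof (rule antisym)
      show "(SUP n. ennreal (?h v * indicator {0..real n} v)) \<le> ennreal (?h v * indicator {0..} v)"
        using P by (intro SUP_least ennreal_leI) (auto simp: indicator_def)
      show "ennreal (?h v * indicator {0..} v) \<le> (SUP n. ennreal (?h v * indicator {0..real n} v))"
        using n by (intro SUP_upper2[of n]) (auto simp: indicator_def)
    qed
  qed
  also have "(\<lambda>x. SUP n. ennreal (?f x * indicator {0..P * (real n)\<^sup>2} x)) = (\<lambda>x. ennreal (indicator {0..} x * x powr (c - 1) / exp x))"
  proof
    fix x :: real
    obtain n where n: "max 1 (x / P) \<le> real n" using real_arch_simple by blast
    have "x \<le> P * real n" using n P by (simp add: field_simps)
    also have "\<dots> \<le> P * (real n)\<^sup>2" using n P by (simp add: power2_eq_square mult_left_le)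
    finally have xn: "x \<le> P * (real n)\<^sup>2" .
    show "(SUP n. ennreal (?f x * indicator {0..P * (real n)\<^sup>2} x)) = ennreal (indicator {0..} x * x powr (c - 1) / exp x)"
    proof (rule antisym)
      show "(SUP n. ennreal (?f x * indicator {0..P * (real n)\<^sup>2} x)) \<le> ennreal (indicator {0..} x * x powr (c - 1) / exp x)"
        by (intro SUP_least ennreal_leI) (auto simp: indicator_def)
      show "ennreal (indicator {0..} x * x powr (c - 1) / exp x) \<le> (SUP n. ennreal (?f x * indicator {0..P * (real n)\<^sup>2} x))"
        using xn by (intro SUP_upper2[of n]) (auto simp: indicator_def)
    qed
  qed
  also note Gamma_conv_nn_integral_real[OF c, symmetric]
  finally have "ennreal (Gamma c) = (\<integral>\<^sup>+v. ennreal (?h v * indicator {0..} v) \<partial>lborel)" .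
  also have "\<dots> = (\<integral>\<^sup>+v. ennreal (2 * P powr c) * (ennreal (v powr (2 * c - 1) * exp (- P * v\<^sup>2)) * indicator {0<..} v) \<partial>lborel)"
  proof (rule nn_integral_cong)
    fix v :: real
    show "ennreal (?h v * indicator {0..} v) = ennreal (2 * P powr c) * (ennreal (v powr (2 * c - 1) * exp (- P * v\<^sup>2)) * indicator {0<..} v)"
    proof (cases "v > 0")
      case True
      have "(v\<^sup>2) powr (c - 1) = v powr (2 * c - 2)"
        using True powr_powr[of v 2 "c - 1"] by (simp add: algebra_simps)
      moreover have "v powr (2 * c - 1) = v powr (2 * c - 2) * v"
        using True powr_add[of v "2 * c - 2" 1] by simp
      moreover have "P powr c = P powr (c - 1) * P"
        using P powr_add[of P "c - 1" 1] by simp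
      ultimately have "?h v = 2 * P powr c * (v powr (2 * c - 1) * exp (- P * v\<^sup>2))"
        using P True by (simp add: powr_mult exp_minus field_simps)
      then show ?thesis using True P by (simp add: ennreal_mult' indicator_def)
    qed (auto simp: indicator_def)
  qed
  also have "\<dots> = ennreal (2 * P powr c) * (\<integral>\<^sup>+v\<in>{0<..}. ennreal (v powr (2 * c - 1) * exp (- P * v\<^sup>2)) \<partial>lborel)"
    by (rule nn_integral_cmult) measurable
  finally have *: "ennreal (Gamma c) = ennreal (2 * P powr c) * (\<integral>\<^sup>+v\<in>{0<..}. ennreal (v powr (2 * c - 1) * exp (- P * v\<^sup>2)) \<partial>lborel)" .
  have "ennreal (Gamma c / (2 * P powr c)) = ennreal (Gamma c) / ennreal (2 * P powr c)"
    using P c by (intro divide_ennreal[symmetric]) (auto intro: less_imp_le)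
  also have "\<dots> = (\<integral>\<^sup>+v\<in>{0<..}. ennreal (v powr (2 * c - 1) * exp (- P * v\<^sup>2)) \<partial>lborel)"
    unfolding * using P by (subst mult.commute) (intro ennreal_mult_divide_eq, auto)
  finally show ?thesis ..
qed

section \<open>The semigroup law and the total mass\<close>

lemma suminf_ennreal_swap:
  fixes f :: "nat \<Rightarrow> nat \<Rightarrow> ennreal"
  shows "(\<Sum>i. \<Sum>j. f i j) = (\<Sum>j. \<Sum>i. f i j)"
  using nn_integral_suminf[of "\<lambda>j i. f i j" "count_space UNIV"]
  by (simp add: nn_integral_count_space_nat)

lemma suminf_ennreal_shift:
  fixes f :: "nat \<Rightarrow> ennreal"
  shows "(\<Sum>k. if m \<le> k then f (k - m) else 0) = (\<Sum>i. f i)"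
proof -
  have "(\<Sum>k. if m \<le> k then f (k - m) else 0)
      = (\<Sum>i. if m \<le> i + m then f (i + m - m) else 0) + (\<Sum>k<m. if m \<le> k then f (k - m) else 0)"
    by (rule suminf_offset) auto
  then show ?thesis by simp
qed

text \<open>
  The Chu--Vandermonde identity \<open>\<Sum>\<^sub>m (k choose m) (l + a gchoose (l - m)) = (k + l + a gchoose l)\<close>,
  written with Gamma functions.
\<close>

lemma bessel_coeff_convolution:
  assumes a: "a > -1"
  shows "(\<Sum>m\<le>l. if m \<le> k then bessel_coeff a m / (fact (k - m) * fact (l - m)) else 0)
    = Gamma (real k + real l + a + 1) * bessel_coeff a k * bessel_coeff a l"
proof -
  have np: "x \<notin> \<int>\<^sub>\<le>\<^sub>0" if "x > 0" for x :: real using that by (auto elim!: nonpos_Ints_cases)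
  have term_eq: "(real k gchoose m) * ((real l + a) gchoose (l - m))
     = fact k * Gamma (real l + a + 1) *
        (if m \<le> k then bessel_coeff a m / (fact (k - m) * fact (l - m)) else 0)" if "m \<le> l" for m
  proof -
    have "((real l + a) gchoose (l - m)) = Gamma (real l + a + 1) / (fact (l - m) * Gamma (real m + a + 1))"
      using that a by (subst gbinomial_Gamma) (auto intro!: np simp: of_nat_diff algebra_simps)
    moreover have "(real k gchoose m) = (if m \<le> k then fact k / (fact m * fact (k - m)) else 0)"
      unfolding binomial_gbinomial[symmetric] by (auto simp: binomial_fact)
    ultimately show ?thesis by (simp add: bessel_coeff_def)
  qed
  have "(real k + (real l + a)) gchoose l = (\<Sum>m\<in>{0..l}. (real k gchoose m) * ((real l + a) gchoose (l - m)))"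
    by (rule gbinomial_Vandermonde[symmetric])
  also have "\<dots> = fact k * Gamma (real l + a + 1) *
        (\<Sum>m\<le>l. if m \<le> k then bessel_coeff a m / (fact (k - m) * fact (l - m)) else 0)"
    unfolding sum_distrib_left atMost_atLeast0 by (rule sum.cong) (auto simp: term_eq)
  finally have *: "(real k + (real l + a)) gchoose l = \<dots>" .
  have "(real k + (real l + a)) gchoose l = Gamma (real k + real l + a + 1) / (fact l * Gamma (real k + a + 1))"
    using a by (subst gbinomial_Gamma) (auto intro!: np simp: algebra_simps)
  with * have "Gamma (real k + real l + a + 1) / (fact l * Gamma (real k + a + 1))
     = fact k * Gamma (real l + a + 1) *
        (\<Sum>m\<le>l. if m \<le> k then bessel_coeff a m / (fact (k - m) * fact (l - m)) else 0)" by (simp only:)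
  moreover have "Gamma (real l + a + 1) > 0" using a by (intro Gamma_real_pos) simp
  moreover have "S = G / (fk * gk) / (fl * gl)" if "G / (fl * gk) = fk * gl * S" "gl > 0" "fk > 0"
    for G fl gk fk gl S :: real
  proof -
    have "S = (fk * gl * S) / (fk * gl)" using that by simp
    then show ?thesis unfolding that(1)[symmetric] by (simp add: mult_ac)
  qed
  ultimately show ?thesis unfolding bessel_coeff_def[of a k] bessel_coeff_def[of a l]
    by (metis (no_types, lifting) divide_divide_eq_left fact_gt_zero mult.right_neutral times_divide_eq_right)
qed

text \<open>
  Multiply the series of \<open>exp A\<close>, \<open>exp B\<close> and the Bessel series at \<open>A B\<close>, and collect the coefficient of
  \<open>A\<^sup>k B\<^sup>l\<close>: it is the convolution evaluated in \<open>bessel_coeff_convolution\<close>.  All terms are nonnegative, so the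
  sums may be rearranged in \<open>[0, \<infinity>]\<close>.
\<close>

lemma bessel_series_addition_formula:
  assumes a: "a > -1" and A: "A \<ge> 0" and B: "B \<ge> 0"
  shows "(\<Sum>k. \<Sum>l. ennreal (A ^ k * B ^ l * (Gamma (real k + real l + a + 1) * bessel_coeff a k * bessel_coeff a l)))
     = ennreal (exp (A + B) * bessel_series a (A * B))"
proof -
  have ex: "ennreal (exp x) = (\<Sum>i. ennreal (x ^ i / fact i))" if "x \<ge> 0" for x :: real
    using exp_converges[of x] that
    by (intro suminf_ennreal_eq[symmetric]) (auto simp: divide_inverse mult.commute)
  have be: "ennreal (bessel_series a (A * B)) = (\<Sum>m. ennreal (bessel_coeff a m * (A * B) ^ m))"
    using sums_bessel_series[OF a] A B bessel_coeff_pos[OF a]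
    by (intro suminf_ennreal_eq[symmetric]) (auto simp: less_imp_le)
  let ?r = "\<lambda>m k l. A ^ k * B ^ l * (if m \<le> k \<and> m \<le> l then bessel_coeff a m / (fact (k - m) * fact (l - m)) else 0)"
  have r0: "0 \<le> ?r m k l" for m k l using A B bessel_coeff_pos[OF a, of m] by simp
  have "ennreal (exp (A + B) * bessel_series a (A * B)) = ennreal (exp A) * (ennreal (exp B) * ennreal (bessel_series a (A * B)))"
    using bessel_series_pos[OF a, of "A * B"] A B by (simp add: exp_add ennreal_mult mult.assoc)
  also have "\<dots> = (\<Sum>m. (\<Sum>k. \<Sum>l. ennreal (?r m k l)))"
    unfolding be ennreal_suminf_cmult[symmetric]
  proof (rule suminf_cong)
    fix m
    have "(\<Sum>k. \<Sum>l. ennreal (?r m k l))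
      = (\<Sum>k. if m \<le> k then (\<Sum>l. if m \<le> l then ennreal (A ^ (k - m) / fact (k - m)) * (ennreal (B ^ (l - m) / fact (l - m))
           * ennreal (bessel_coeff a m * (A * B) ^ m)) else 0) else 0)"
    proof (intro suminf_cong)
      fix k
      have *: "?r m k l = A ^ (k - m) / fact (k - m) * (B ^ (l - m) / fact (l - m) * (bessel_coeff a m * (A * B) ^ m))"
        if "m \<le> k" "m \<le> l" for l
        using that power_add[of A "k - m" m] power_add[of B "l - m" m]
        by (simp add: power_mult_distrib)
      have "ennreal (?r m k l) = (if m \<le> k then (if m \<le> l then ennreal (A ^ (k - m) / fact (k - m)) * (ennreal (B ^ (l - m) / fact (l - m))
           * ennreal (bessel_coeff a m * (A * B) ^ m)) else 0) else 0)" for l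
      proof (cases "m \<le> k \<and> m \<le> l")
        case True
        have "0 \<le> bessel_coeff a m * (A * B) ^ m" using A B bessel_coeff_pos[OF a, of m] by simp
        then show ?thesis
          using True *[of l] A B
          by (simp only: simp_thms if_True ennreal_mult[symmetric] mult_nonneg_nonneg divide_nonneg_pos
                zero_le_power fact_gt_zero)
      qed auto
      then show "(\<Sum>l. ennreal (?r m k l)) = (if m \<le> k then (\<Sum>l. if m \<le> l then ennreal (A ^ (k - m) / fact (k - m)) * (ennreal (B ^ (l - m) / fact (l - m))
           * ennreal (bessel_coeff a m * (A * B) ^ m)) else 0) else 0)"
        by simp
    qed
    also have "\<dots> = (\<Sum>i. \<Sum>j. ennreal (A ^ i / fact i) * (ennreal (B ^ j / fact j) * ennreal (bessel_coeff a m * (A * B) ^ m)))"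
      unfolding suminf_ennreal_shift[of m "\<lambda>j. c * (ennreal (B ^ j / fact j) * d)" for c d]
      by (rule suminf_ennreal_shift[of m "\<lambda>i. (\<Sum>j. ennreal (A ^ i / fact i) * (ennreal (B ^ j / fact j) * ennreal (bessel_coeff a m * (A * B) ^ m)))"])
    also have "\<dots> = ennreal (exp A) * (ennreal (exp B) * ennreal (bessel_coeff a m * (A * B) ^ m))"
      unfolding ex[OF A] ex[OF B] by simp
    finally show "ennreal (exp A) * (ennreal (exp B) * ennreal (bessel_coeff a m * (A * B) ^ m))
       = (\<Sum>k. \<Sum>l. ennreal (?r m k l))" ..
  qed
  also have "\<dots> = (\<Sum>k. \<Sum>m. \<Sum>l. ennreal (?r m k l))"
    by (rule suminf_ennreal_swap)
  also have "\<dots> = (\<Sum>k. \<Sum>l. \<Sum>m. ennreal (?r m k l))"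
    by (intro suminf_cong suminf_ennreal_swap)
  also have "\<dots> = (\<Sum>k. \<Sum>l. ennreal (A ^ k * B ^ l * (Gamma (real k + real l + a + 1) * bessel_coeff a k * bessel_coeff a l)))"
  proof (intro suminf_cong)
    fix k l
    have "(\<Sum>m. ennreal (?r m k l)) = (\<Sum>m\<le>l. ennreal (?r m k l))"
      by (rule suminf_finite) auto
    also have "\<dots> = ennreal (\<Sum>m\<le>l. ?r m k l)"
      by (rule sum_ennreal) (rule r0)
    also have "(\<Sum>m\<le>l. ?r m k l) = A ^ k * B ^ l * (\<Sum>m\<le>l. if m \<le> k then bessel_coeff a m / (fact (k - m) * fact (l - m)) else 0)"
      unfolding sum_distrib_left by (rule sum.cong) auto
    finally show "(\<Sum>m. ennreal (?r m k l)) = ennreal (A ^ k * B ^ l * (Gamma (real k + real l + a + 1) * bessel_coeff a k * bessel_coeff a l))"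
      unfolding bessel_coeff_convolution[OF a] .
  qed
  finally show ?thesis ..
qed

text \<open>
  Expand both kernels in powers of \<open>v\<close> and integrate termwise against the Gaussian factor, whose rate is
  \<open>P = p + q\<close> with \<open>p = 1/(4t)\<close> and \<open>q = 1/(4s)\<close>.  The resulting double series is summed by
  \<open>bessel_series_addition_formula\<close> with \<open>A = (p u)\<^sup>2/P\<close> and \<open>B = (q w)\<^sup>2/P\<close>.  The rate at time \<open>t + s\<close> is \<open>p q / P\<close>.
\<close>

lemma bessel_kernel_semigroup:
  assumes a: "a > -1" and t: "t > 0" and s: "s > 0" and u: "u > 0" and w: "w > 0"
  shows "(\<integral>\<^sup>+v\<in>{0<..}. ennreal (bessel_kernel a t u v * bessel_kernel a s v w * v powr (2 * a + 1)) \<partial>lborel)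
    = ennreal (bessel_kernel a (t + s) u w)"
proof -
  define p q where "p = 1 / (4 * t)" and "q = 1 / (4 * s)"
  define P A B where "P = p + q" and "A = (p * u)\<^sup>2 / P" and "B = (q * w)\<^sup>2 / P"
  define D where "D = 4 * p powr (a + 1) * q powr (a + 1) * exp (- p * u\<^sup>2) * exp (- q * w\<^sup>2)"
  have pq: "p > 0" "q > 0" "P > 0" using t s by (auto simp: p_def q_def P_def add_pos_pos)
  have AB: "A \<ge> 0" "B \<ge> 0" using pq by (auto simp: A_def B_def)
  have D0: "D > 0" using pq by (simp add: D_def)
  note c0 = bessel_coeff_pos[OF a, THEN less_imp_le]
  let ?c = "\<lambda>k l. D * (bessel_coeff a k * bessel_coeff a l * ((p * u)\<^sup>2) ^ k * ((q * w)\<^sup>2) ^ l)"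
  let ?g = "\<lambda>k l v. v powr (2 * (real k + real l + a + 1) - 1) * exp (- P * v\<^sup>2)"
  have cnn: "0 \<le> ?c k l" for k l
    using D0 c0 by (intro mult_nonneg_nonneg) auto
  have bes_ser: "ennreal (bessel_series a x) = (\<Sum>k. ennreal (bessel_coeff a k * x ^ k))" if "x \<ge> 0" for x
    using sums_bessel_series[OF a, of x] c0 that by (intro suminf_ennreal_eq[symmetric]) auto
  have ptw: "ennreal (bessel_kernel a t u v * bessel_kernel a s v w * v powr (2 * a + 1))
      = (\<Sum>k. \<Sum>l. ennreal (?c k l) * ennreal (?g k l v))" if v: "v > 0" for v
  proof -
    let ?E = "D * (v powr (2 * a + 1) * exp (- P * v\<^sup>2))"
    have ex: "exp (- p * (u\<^sup>2 + v\<^sup>2)) * exp (- q * (v\<^sup>2 + w\<^sup>2)) = exp (- p * u\<^sup>2) * exp (- q * w\<^sup>2) * exp (- P * v\<^sup>2)"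
      unfolding exp_add[symmetric] by (simp add: P_def algebra_simps)
    have "bessel_kernel a t u v * bessel_kernel a s v w * v powr (2 * a + 1)
      = 4 * p powr (a + 1) * q powr (a + 1) * (exp (- p * (u\<^sup>2 + v\<^sup>2)) * exp (- q * (v\<^sup>2 + w\<^sup>2)))
          * v powr (2 * a + 1) * (bessel_series a ((p * u * v)\<^sup>2) * bessel_series a ((q * v * w)\<^sup>2))"
      unfolding bessel_kernel_eq_series[OF a t u v] bessel_kernel_eq_series[OF a s v w] p_def q_def by simp
    also have "\<dots> = ?E * (bessel_series a ((p * u * v)\<^sup>2) * bessel_series a ((q * v * w)\<^sup>2))"
      unfolding ex D_def by simp
    finally have e: "bessel_kernel a t u v * bessel_kernel a s v w * v powr (2 * a + 1)
      = ?E * (bessel_series a ((p * u * v)\<^sup>2) * bessel_series a ((q * v * w)\<^sup>2))" .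
    have "0 \<le> ?E" "0 \<le> bessel_series a ((p * u * v)\<^sup>2)" "0 \<le> bessel_series a ((q * v * w)\<^sup>2)"
      using D0 by (auto intro!: mult_nonneg_nonneg less_imp_le[OF bessel_series_pos[OF a]])
    then have "ennreal (bessel_kernel a t u v * bessel_kernel a s v w * v powr (2 * a + 1))
      = ennreal ?E * (ennreal (bessel_series a ((p * u * v)\<^sup>2)) * ennreal (bessel_series a ((q * v * w)\<^sup>2)))"
      by (simp only: e ennreal_mult[symmetric] mult_nonneg_nonneg)
    also have "\<dots> = (\<Sum>k. \<Sum>l. ennreal ?E * (ennreal (bessel_coeff a k * ((p * u * v)\<^sup>2) ^ k) * ennreal (bessel_coeff a l * ((q * v * w)\<^sup>2) ^ l)))"
      by (simp add: bes_ser)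
    also have "\<dots> = (\<Sum>k. \<Sum>l. ennreal (?c k l) * ennreal (?g k l v))"
    proof (intro suminf_cong)
      fix k l
      have vv: "v powr (2 * (real k + real l + a + 1) - 1) = v powr (2 * a + 1) * ((v\<^sup>2) ^ k * (v\<^sup>2) ^ l)"
        using v powr_add[of v "2 * a + 1" "real (2 * k + 2 * l)"] powr_realpow[of v "2 * k + 2 * l"]
        by (simp add: power_add power_mult[symmetric] algebra_simps)
      have "?E * (bessel_coeff a k * ((p * u * v)\<^sup>2) ^ k * (bessel_coeff a l * ((q * v * w)\<^sup>2) ^ l)) = ?c k l * ?g k l v"
        unfolding vv by (simp add: power_mult_distrib)
      moreover have "ennreal ?E * (ennreal (bessel_coeff a k * ((p * u * v)\<^sup>2) ^ k) * ennreal (bessel_coeff a l * ((q * v * w)\<^sup>2) ^ l))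
        = ennreal (?E * (bessel_coeff a k * ((p * u * v)\<^sup>2) ^ k * (bessel_coeff a l * ((q * v * w)\<^sup>2) ^ l)))"
        using D0 c0 by (simp only: ennreal_mult' ennreal_mult'' mult_nonneg_nonneg zero_le_power zero_le_power2)
      moreover have "ennreal (?c k l) * ennreal (?g k l v) = ennreal (?c k l * ?g k l v)"
        by (rule ennreal_mult[symmetric, OF cnn]) simp
      ultimately show "ennreal ?E * (ennreal (bessel_coeff a k * ((p * u * v)\<^sup>2) ^ k) * ennreal (bessel_coeff a l * ((q * v * w)\<^sup>2) ^ l))
        = ennreal (?c k l) * ennreal (?g k l v)" by (simp only:)
    qed
    finally show ?thesis .
  qed
  have "(\<integral>\<^sup>+v\<in>{0<..}. ennreal (bessel_kernel a t u v * bessel_kernel a s v w * v powr (2 * a + 1)) \<partial>lborel)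
     = (\<integral>\<^sup>+v. (\<Sum>k. \<Sum>l. ennreal (?c k l) * (ennreal (?g k l v) * indicator {0<..} v)) \<partial>lborel)"
  proof (rule nn_integral_cong)
    fix v :: real
    show "ennreal (bessel_kernel a t u v * bessel_kernel a s v w * v powr (2 * a + 1)) * indicator {0<..} v
      = (\<Sum>k. \<Sum>l. ennreal (?c k l) * (ennreal (?g k l v) * indicator {0<..} v))"
      using ptw[of v] by (cases "v > 0") (simp_all add: indicator_def)
  qed
  also have "\<dots> = (\<Sum>k. \<Sum>l. (\<integral>\<^sup>+v. ennreal (?c k l) * (ennreal (?g k l v) * indicator {0<..} v) \<partial>lborel))"
    by (simp add: nn_integral_suminf)
  also have "\<dots> = (\<Sum>k. \<Sum>l. ennreal (D / (2 * P powr (a + 1))) * ennreal (A ^ k * B ^ l * (Gamma (real k + real l + a + 1) * bessel_coeff a k * bessel_coeff a l)))"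
  proof (intro suminf_cong)
    fix k l
    have g: "Gamma (real k + real l + a + 1) \<ge> 0" using a by (intro less_imp_le Gamma_real_pos) simp
    have PP: "P powr (real k + real l + a + 1) = P powr (a + 1) * (P ^ k * P ^ l)"
      using pq powr_add[of P "a + 1" "real (k + l)"] powr_realpow[of P "k + l"] by (simp add: power_add add_ac)
    have "(\<integral>\<^sup>+v. ennreal (?c k l) * (ennreal (?g k l v) * indicator {0<..} v) \<partial>lborel)
       = ennreal (?c k l) * (\<integral>\<^sup>+v\<in>{0<..}. ennreal (?g k l v) \<partial>lborel)"
      by (rule nn_integral_cmult) measurable
    also have "(\<integral>\<^sup>+v\<in>{0<..}. ennreal (?g k l v) \<partial>lborel) = ennreal (Gamma (real k + real l + a + 1) / (2 * P powr (real k + real l + a + 1)))"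
      using a by (intro nn_integral_powr_gaussian pq(3)) simp
    also have "ennreal (?c k l) * \<dots> = ennreal (?c k l * (Gamma (real k + real l + a + 1) / (2 * P powr (real k + real l + a + 1))))"
      using g by (intro ennreal_mult[symmetric] cnn) simp
    also have "?c k l * (Gamma (real k + real l + a + 1) / (2 * P powr (real k + real l + a + 1)))
       = D / (2 * P powr (a + 1)) * (A ^ k * B ^ l * (Gamma (real k + real l + a + 1) * bessel_coeff a k * bessel_coeff a l))"
      unfolding PP A_def B_def power_divide by (simp add: mult_ac)
    also have "ennreal \<dots> = ennreal (D / (2 * P powr (a + 1))) * ennreal (A ^ k * B ^ l * (Gamma (real k + real l + a + 1) * bessel_coeff a k * bessel_coeff a l))"
      using D0 AB g c0 by (intro ennreal_mult mult_nonneg_nonneg divide_nonneg_nonneg) auto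
    finally show "(\<integral>\<^sup>+v. ennreal (?c k l) * (ennreal (?g k l v) * indicator {0<..} v) \<partial>lborel) = \<dots>" .
  qed
  also have "\<dots> = ennreal (D / (2 * P powr (a + 1))) * ennreal (exp (A + B) * bessel_series a (A * B))"
    by (simp add: bessel_series_addition_formula[OF a AB])
  also have "\<dots> = ennreal (D / (2 * P powr (a + 1)) * (exp (A + B) * bessel_series a (A * B)))"
    using D0 bessel_series_pos[OF a, of "A * B"] AB by (intro ennreal_mult[symmetric]) auto
  also have "D / (2 * P powr (a + 1)) * (exp (A + B) * bessel_series a (A * B)) = bessel_kernel a (t + s) u w"
  proof -
    define r where "r = 1 / (4 * (t + s))"
    have ts: "t + s > 0" using t s by simp
    have r: "r = p * q / P" using t s by (simp add: r_def p_def q_def P_def field_simps)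
    have "r powr (a + 1) = p powr (a + 1) * q powr (a + 1) / P powr (a + 1)"
      unfolding r using pq by (simp add: powr_mult powr_divide)
    moreover have "A * B = (r * u * w)\<^sup>2"
      unfolding A_def B_def r using pq by (simp add: power2_eq_square field_simps)
    moreover have "- p * u\<^sup>2 + - q * w\<^sup>2 + (A + B) = - r * (u\<^sup>2 + w\<^sup>2)"
    proof -
      have "A + r * u\<^sup>2 = (p * u\<^sup>2 * P) / P"
        unfolding A_def r times_divide_eq_left add_divide_distrib[symmetric]
        by (simp add: P_def power2_eq_square algebra_simps)
      moreover have "B + r * w\<^sup>2 = (q * w\<^sup>2 * P) / P"
        unfolding B_def r times_divide_eq_left add_divide_distrib[symmetric]
        by (simp add: P_def power2_eq_square algebra_simps)
      ultimately show ?thesis using pq(3) by (simp add: algebra_simps)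
    qed
    then have "exp (- r * (u\<^sup>2 + w\<^sup>2)) = exp (- p * u\<^sup>2) * exp (- q * w\<^sup>2) * exp (A + B)"
      by (metis exp_add)
    ultimately show ?thesis
      unfolding bessel_kernel_eq_series[OF a ts u w] r_def[symmetric] D_def by simp
  qed
  finally show ?thesis .
qed

lemma twisted_kernel_semigroup:
  assumes a: "a > -1" and t: "t > 0" and s: "s > 0" and u: "u > 0" and w: "w > 0"
  shows "(\<integral>\<^sup>+v\<in>{0<..}. ennreal (twisted_kernel c a t u v * twisted_kernel c a s v w * v powr (2 * a + 1 - 2 * c)) \<partial>lborel)
    = ennreal (twisted_kernel c a (t + s) u w)"
proof -
  have "(\<integral>\<^sup>+v\<in>{0<..}. ennreal (twisted_kernel c a t u v * twisted_kernel c a s v w * v powr (2 * a + 1 - 2 * c)) \<partial>lborel)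
    = (\<integral>\<^sup>+v. ennreal ((u * w) powr c) * (ennreal (bessel_kernel a t u v * bessel_kernel a s v w * v powr (2 * a + 1)) * indicator {0<..} v) \<partial>lborel)"
  proof (rule nn_integral_cong)
    fix v :: real
    have "twisted_kernel c a t u v * twisted_kernel c a s v w * v powr (2 * a + 1 - 2 * c)
      = (u * w) powr c * (bessel_kernel a t u v * bessel_kernel a s v w * v powr (2 * a + 1))" if v: "v > 0"
    proof -
      have "v powr (2 * a + 1) = v powr c * v powr c * v powr (2 * a + 1 - 2 * c)"
        unfolding powr_add[symmetric] by simp
      then show ?thesis unfolding twisted_kernel_def using u v w by (simp add: powr_mult)
    qed
    then show "ennreal (twisted_kernel c a t u v * twisted_kernel c a s v w * v powr (2 * a + 1 - 2 * c)) * indicator {0<..} v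
      = ennreal ((u * w) powr c) * (ennreal (bessel_kernel a t u v * bessel_kernel a s v w * v powr (2 * a + 1)) * indicator {0<..} v)"
      by (cases "v > 0") (simp_all add: ennreal_mult')
  qed
  also have "\<dots> = ennreal ((u * w) powr c) * (\<integral>\<^sup>+v\<in>{0<..}. ennreal (bessel_kernel a t u v * bessel_kernel a s v w * v powr (2 * a + 1)) \<partial>lborel)"
    unfolding bessel_kernel_def by (rule nn_integral_cmult) measurable
  also have "\<dots> = ennreal (twisted_kernel c a (t + s) u w)"
    unfolding bessel_kernel_semigroup[OF assms] twisted_kernel_def by (simp add: ennreal_mult')
  finally show ?thesis .
qed

text \<open>
  The derivative in \<open>z\<close> of the partial sum telescopes to the Gamma density
  \<open>exp (-z) z powr (a - 1) / \<Gamma>(a)\<close> minus a nonnegative term.  Hence the partial sum is at most the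
  mass which the Gamma distribution gives to \<open>[0, z]\<close>.
\<close>

lemma incomplete_gamma_series_le:
  fixes a z :: real
  assumes a: "a > 0" and z: "z > 0"
  shows "(\<Sum>k<n. exp (- z) * z powr (real k + a) / Gamma (real k + a + 1)) \<le> 1"
proof -
  let ?D = "\<lambda>n s. \<Sum>k<n. exp (- s) * s powr (real k + a) / Gamma (real k + a + 1)"
  let ?d = "\<lambda>n s. exp (- s) * (s powr (a - 1) / Gamma a - s powr (real n + a - 1) / Gamma (real n + a))"
  have der: "(?D n has_real_derivative ?d n s) (at s)" if s: "s > 0" for n s
  proof (induction n)
    case (Suc n)
    have na: "real n + a > 0" using a by (simp add: add_nonneg_pos)
    have G: "Gamma (real n + a + 1) = (real n + a) * Gamma (real n + a)" "Gamma (real n + a) > 0"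
      using na by (auto intro: Gamma_plus1_pos)
    have "((\<lambda>s. exp (- s) * s powr y / (y * g)) has_real_derivative
      exp (- s) * (s powr (y - 1) / g - s powr y / (y * g))) (at s)" if "y > 0" "g > 0" for y g
    proof -
      have "((\<lambda>s. exp (- s) * s powr y / (y * g)) has_real_derivative
        (- exp (- s) * s powr y + (y * s powr (y - 1)) * exp (- s)) / (y * g)) (at s)"
        using s by (intro DERIV_cdivide DERIV_mult has_real_derivative_powr) (auto intro!: derivative_eq_intros)
      moreover have "(- exp (- s) * s powr y + (y * s powr (y - 1)) * exp (- s)) / (y * g)
        = exp (- s) * (s powr (y - 1) / g - s powr y / (y * g))"
        using that by (simp add: field_simps)
      ultimately show ?thesis by simp
    qed
    from this[OF na G(2)]
    have "((\<lambda>s. exp (- s) * s powr (real n + a) / Gamma (real n + a + 1)) has_real_derivative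
      exp (- s) * (s powr (real n + a - 1) / Gamma (real n + a) - s powr (real n + a) / Gamma (real n + a + 1))) (at s)"
      unfolding G(1) .
    from DERIV_add[OF Suc.IH this] show ?case
      by (simp add: algebra_simps)
  qed simp
  have "(?d n has_integral (?D n z - ?D n 0)) {0..z}"
  proof (rule fundamental_theorem_of_calculus_interior)
    show "continuous_on {0..z} (?D n)"
      using a Gamma_real_pos by (intro continuous_intros continuous_on_powr') (auto simp: add_nonneg_pos intro!: Gamma_real_pos less_imp_neq[symmetric])
    show "(?D n has_vector_derivative ?d n s) (at s)" if "s \<in> {0<..<z}" for s
      using der[of s n] that by (simp add: has_real_derivative_iff_has_vector_derivative)
  qed (use z in simp)
  moreover have "?D n 0 = 0" by simp
  ultimately have 1: "(?d n has_integral ?D n z) {0..z}" by simp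
  have G: "((\<lambda>t. (t powr (a - 1) / exp t) / Gamma a) has_integral 1) {0..}"
    using has_integral_divide[OF Gamma_integral_real[OF a], of "Gamma a"] Gamma_real_pos[OF a] by simp
  then have "(\<lambda>t. (t powr (a - 1) / exp t) / Gamma a) integrable_on {0..z}"
    using integrable_on_subinterval[OF has_integral_integrable[OF G], of 0 z] by simp
  then have 2: "((\<lambda>t. (t powr (a - 1) / exp t) / Gamma a) has_integral integral {0..z} (\<lambda>t. (t powr (a - 1) / exp t) / Gamma a)) {0..z}"
    by (rule integrable_integral)
  have "integral {0..z} (\<lambda>t. (t powr (a - 1) / exp t) / Gamma a) \<le> 1"
    by (rule has_integral_subset_le[OF _ 2 G]) (use a in \<open>auto intro!: divide_nonneg_pos\<close>)
  moreover have "?D n z \<le> integral {0..z} (\<lambda>t. (t powr (a - 1) / exp t) / Gamma a)"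
  proof (rule has_integral_le[OF 1 2])
    fix s assume "s \<in> {0..z}"
    have "exp (- s) * (s powr (real n + a - 1) / Gamma (real n + a)) \<ge> 0"
      using a by (intro mult_nonneg_nonneg divide_nonneg_nonneg less_imp_le[OF Gamma_real_pos]) auto
    then show "?d n s \<le> s powr (a - 1) / exp s / Gamma a"
      by (simp add: right_diff_distrib exp_minus field_simps)
  qed
  ultimately show ?thesis by simp
qed

text \<open>
  Termwise integration with \<open>z = u\<^sup>2/(4t)\<close> gives \<open>exp (-z) \<Sum> z\<^sup>k/k!\<close> when \<open>c = 0\<close>, and the incomplete Gamma
  series \<open>exp (-z) \<Sum> z powr (k + a) / \<Gamma>(k + a + 1)\<close> when \<open>c = 2 a\<close>.  The latter tends to \<open>0\<close> as \<open>u\<close>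
  does: mass is absorbed at the origin.
\<close>

lemma twisted_kernel_mass:
  assumes a: "a > -1" and c: "c = 0 \<or> 0 < a \<and> c = 2 * a" and t: "t > 0" and u: "u > 0"
  shows "(\<integral>\<^sup>+v\<in>{0<..}. ennreal (twisted_kernel c a t u v * v powr (2 * a + 1 - 2 * c)) \<partial>lborel) \<le> 1"
proof -
  define p where "p = 1 / (4 * t)"
  define z where "z = p * u\<^sup>2"
  define D where "D = 2 * p powr (a + 1) * exp (- z) * u powr c"
  have p: "p > 0" using t by (simp add: p_def)
  have z: "z > 0" using p u by (simp add: z_def)
  have D0: "D > 0" using p u by (simp add: D_def)
  define b where "b k = real k + a + 1 - c / 2" for k :: nat
  have b: "b k > 0" for k using a c by (auto simp: b_def)
  note c0 = bessel_coeff_pos[OF a, THEN less_imp_le]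
  have bes_ser: "ennreal (bessel_series a x) = (\<Sum>k. ennreal (bessel_coeff a k * x ^ k))" if "x \<ge> 0" for x
    using sums_bessel_series[OF a, of x] c0 that by (intro suminf_ennreal_eq[symmetric]) auto
  let ?c = "\<lambda>k. D * (bessel_coeff a k * ((p * u)\<^sup>2) ^ k)"
  let ?g = "\<lambda>k v. v powr (2 * b k - 1) * exp (- p * v\<^sup>2)"
  have cnn: "0 \<le> ?c k" for k
    using D0 c0 by (intro mult_nonneg_nonneg) auto
  have ptw: "ennreal (twisted_kernel c a t u v * v powr (2 * a + 1 - 2 * c))
      = (\<Sum>k. ennreal (?c k) * ennreal (?g k v))" if v: "v > 0" for v
  proof -
    let ?E = "D * (v powr (2 * a + 1 - c) * exp (- p * v\<^sup>2))"
    have "exp (- p * (u\<^sup>2 + v\<^sup>2)) = exp (- z) * exp (- p * v\<^sup>2)"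
      unfolding exp_add[symmetric] by (simp add: z_def algebra_simps)
    moreover have "v powr (2 * a + 1 - c) = v powr c * v powr (2 * a + 1 - 2 * c)"
      unfolding powr_add[symmetric] by simp
    ultimately have "twisted_kernel c a t u v * v powr (2 * a + 1 - 2 * c) = ?E * bessel_series a ((p * u * v)\<^sup>2)"
      unfolding twisted_kernel_def bessel_kernel_eq_series[OF a t u v] D_def using u v
      by (simp add: p_def powr_mult)
    then have "ennreal (twisted_kernel c a t u v * v powr (2 * a + 1 - 2 * c)) = ennreal ?E * ennreal (bessel_series a ((p * u * v)\<^sup>2))"
      using D0 by (simp add: ennreal_mult' ennreal_mult'' bessel_series_pos[OF a, THEN less_imp_le])
    also have "\<dots> = (\<Sum>k. ennreal ?E * ennreal (bessel_coeff a k * ((p * u * v)\<^sup>2) ^ k))"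
      by (simp add: bes_ser)
    also have "\<dots> = (\<Sum>k. ennreal (?c k) * ennreal (?g k v))"
    proof (intro suminf_cong)
      fix k
      have "v powr (2 * b k - 1) = v powr (2 * a + 1 - c) * (v\<^sup>2) ^ k"
        using v powr_add[of v "2 * a + 1 - c" "real (2 * k)"] powr_realpow[of v "2 * k"]
        by (simp add: power_mult[symmetric] b_def algebra_simps)
      then have "?E * (bessel_coeff a k * ((p * u * v)\<^sup>2) ^ k) = ?c k * ?g k v"
        by (simp add: power_mult_distrib)
      moreover have "ennreal ?E * ennreal (bessel_coeff a k * ((p * u * v)\<^sup>2) ^ k) = ennreal (?E * (bessel_coeff a k * ((p * u * v)\<^sup>2) ^ k))"
        using D0 c0 by (intro ennreal_mult[symmetric] mult_nonneg_nonneg) auto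
      moreover have "ennreal (?c k) * ennreal (?g k v) = ennreal (?c k * ?g k v)"
        by (rule ennreal_mult[symmetric, OF cnn]) simp
      ultimately show "ennreal ?E * ennreal (bessel_coeff a k * ((p * u * v)\<^sup>2) ^ k) = ennreal (?c k) * ennreal (?g k v)"
        by (simp only:)
    qed
    finally show ?thesis .
  qed
  have "(\<integral>\<^sup>+v\<in>{0<..}. ennreal (twisted_kernel c a t u v * v powr (2 * a + 1 - 2 * c)) \<partial>lborel)
     = (\<integral>\<^sup>+v. (\<Sum>k. ennreal (?c k) * (ennreal (?g k v) * indicator {0<..} v)) \<partial>lborel)"
  proof (rule nn_integral_cong)
    fix v :: real
    show "ennreal (twisted_kernel c a t u v * v powr (2 * a + 1 - 2 * c)) * indicator {0<..} v
      = (\<Sum>k. ennreal (?c k) * (ennreal (?g k v) * indicator {0<..} v))"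
      using ptw[of v] by (cases "v > 0") (simp_all add: indicator_def)
  qed
  also have "\<dots> = (\<Sum>k. (\<integral>\<^sup>+v. ennreal (?c k) * (ennreal (?g k v) * indicator {0<..} v) \<partial>lborel))"
    by (simp add: nn_integral_suminf)
  also have "\<dots> = (\<Sum>k. ennreal (?c k * (Gamma (b k) / (2 * p powr b k))))"
  proof (intro suminf_cong)
    fix k
    have g: "Gamma (b k) > 0" using b by (intro Gamma_real_pos)
    have "(\<integral>\<^sup>+v. ennreal (?c k) * (ennreal (?g k v) * indicator {0<..} v) \<partial>lborel)
       = ennreal (?c k) * (\<integral>\<^sup>+v\<in>{0<..}. ennreal (?g k v) \<partial>lborel)"
      by (rule nn_integral_cmult) measurable
    also have "(\<integral>\<^sup>+v\<in>{0<..}. ennreal (?g k v) \<partial>lborel) = ennreal (Gamma (b k) / (2 * p powr b k))"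
      by (rule nn_integral_powr_gaussian[OF p b])
    also have "ennreal (?c k) * \<dots> = ennreal (?c k * (Gamma (b k) / (2 * p powr b k)))"
      using g by (intro ennreal_mult[symmetric] cnn) simp
    finally show "(\<integral>\<^sup>+v. ennreal (?c k) * (ennreal (?g k v) * indicator {0<..} v) \<partial>lborel) = \<dots>" .
  qed
  also have "\<dots> \<le> 1"
  proof (rule suminf_le_const)
    fix n
    have nn: "0 \<le> ?c k * (Gamma (b k) / (2 * p powr b k))" for k
      using cnn[of k] Gamma_real_pos[OF b[of k]] by simp
    have pu: "((p * u)\<^sup>2) ^ k = p ^ k * z ^ k" for k
      by (simp add: z_def power_mult_distrib power2_eq_square)
    have "(\<Sum>k<n. ?c k * (Gamma (b k) / (2 * p powr b k))) \<le> 1"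
    proof (cases "c = 0")
      case True
      have "?c k * (Gamma (b k) / (2 * p powr b k)) = exp (- z) * (z ^ k / fact k)" for k
      proof -
        have "p powr b k = p powr (a + 1) * p ^ k"
          using p powr_add[of p "a + 1" "real k"] by (simp add: True b_def powr_realpow add_ac)
        moreover have "Gamma (real k + a + 1) > 0" using b[of k] True by (simp add: b_def)
        ultimately show ?thesis
          unfolding pu using p u by (simp add: True D_def b_def bessel_coeff_def field_simps)
      qed
      then have "(\<Sum>k<n. ?c k * (Gamma (b k) / (2 * p powr b k))) = exp (- z) * (\<Sum>k<n. z ^ k / fact k)"
        by (simp add: sum_distrib_left)
      also have "(\<Sum>k<n. z ^ k / fact k) \<le> exp z"
      proof -
        have "(\<lambda>k. z ^ k / fact k) sums exp z" using exp_converges[of z] by (simp add: divide_inverse mult.commute)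
        then show ?thesis
          using z sum_le_suminf[of "\<lambda>k. z ^ k / fact k" "{..<n}"] by (auto simp: sums_iff)
      qed
      finally show ?thesis by (simp add: exp_minus field_simps)
    next
      case False
      then have ca: "c = 2 * a" "a > 0" using c by auto
      have "?c k * (Gamma (b k) / (2 * p powr b k)) = exp (- z) * z powr (real k + a) / Gamma (real k + a + 1)" for k
      proof -
        have bk: "b k = real k + 1" by (simp add: b_def ca)
        have "p powr b k = p * p ^ k"
          unfolding bk using p powr_add[of p "real k" 1] by (simp add: powr_realpow)
        moreover have "z powr (real k + a) = z ^ k * (p powr a * u powr c)"
        proof -
          have "(u\<^sup>2) powr a = u powr c" using u powr_powr[of u 2 a] by (simp add: ca)
          then have "z powr a = p powr a * u powr c" using p u by (simp add: z_def powr_mult)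
          then show ?thesis using z by (simp add: powr_add powr_realpow)
        qed
        moreover have "p powr (a + 1) = p powr a * p" using p by (simp add: powr_add)
        moreover have "Gamma (b k) = fact k" unfolding bk by (simp add: Gamma_fact add.commute)
        moreover have "Gamma (real k + a + 1) > 0" using ca by (intro Gamma_real_pos) simp
        ultimately show ?thesis
          unfolding pu using p u by (simp add: D_def bessel_coeff_def field_simps)
      qed
      then show ?thesis
        using incomplete_gamma_series_le[OF ca(2) z, of n] by simp
    qed
    then show "(\<Sum>k<n. ennreal (?c k * (Gamma (b k) / (2 * p powr b k)))) \<le> 1"
      by (subst sum_ennreal[OF nn]) (simp add: ennreal_le_1)
  qed simp
  finally show ?thesis .
qed

section \<open>The maximal ergodic inequality\<close>

text \<open>
  The sum \<open>g + T g + \<dots> + T\<^sup>n\<^sup>-\<^sup>1 g\<close>, in Horner form.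
\<close>

fun ergodic_sum :: "(('a \<Rightarrow> ennreal) \<Rightarrow> 'a \<Rightarrow> ennreal) \<Rightarrow> ('a \<Rightarrow> ennreal) \<Rightarrow> nat \<Rightarrow> 'a \<Rightarrow> ennreal" where
  "ergodic_sum T g 0 = (\<lambda>x. 0)"
| "ergodic_sum T g (Suc n) = (\<lambda>x. g x + T (ergodic_sum T g n) x)"

text \<open>
  Subtraction in \<open>[0, \<infinity>]\<close> is truncated at \<open>0\<close>, so this is the recursion
  \<open>M\<^sub>n\<^sub>+\<^sub>1 = max 0 (g - h + T M\<^sub>n)\<close>.  It plays the role of the maximum of the partial sums of \<open>g - h\<close> in
  Garsia's argument, but applies \<open>T\<close> to nonnegative functions only, where it is defined without any
  integrability.
\<close>

primrec truncated_sum ::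
  "(('a \<Rightarrow> ennreal) \<Rightarrow> 'a \<Rightarrow> ennreal) \<Rightarrow> ('a \<Rightarrow> ennreal) \<Rightarrow> ('a \<Rightarrow> ennreal) \<Rightarrow> nat \<Rightarrow> 'a \<Rightarrow> ennreal" where
  "truncated_sum T g h 0 = (\<lambda>x. 0)"
| "truncated_sum T g h (Suc n) = (\<lambda>x. (g x + T (truncated_sum T g h n) x) - h x)"

text \<open>
  Hopf's inequality, by a variant of Garsia's proof.  Write \<open>S\<^sub>n\<close> for the ergodic sums.  Let \<open>A\<close> be the
  set where \<open>S\<^sub>n > n l\<close> for some \<open>n \<le> N\<close>, and \<open>M\<^sub>n\<close> the truncated sums for \<open>g\<close> and \<open>h = l 1\<^sub>A\<close>; they increase
  with \<open>n\<close>.  As \<open>T\<close> does not increase constants,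
  \<open>S\<^sub>n \<le> M\<^sub>n + n l\<close>; so \<open>M\<^sub>N\<^sub>+\<^sub>1 > 0\<close> on \<open>A\<close>, and there no truncation took place in the last step.  Therefore
  \<open>M\<^sub>N\<^sub>+\<^sub>1 + l 1\<^sub>A \<le> g + T M\<^sub>N\<close> everywhere.  Integrate, use that \<open>T\<close> contracts \<open>L\<^sup>1\<close> and that \<open>M\<^sub>N \<le> M\<^sub>N\<^sub>+\<^sub>1\<close>, and
  cancel the finite integral of \<open>M\<^sub>N\<^sub>+\<^sub>1\<close>.
\<close>

proposition maximal_ergodic_inequality:
  fixes T :: "('a \<Rightarrow> ennreal) \<Rightarrow> 'a \<Rightarrow> ennreal" and l :: ennreal
  assumes g[measurable]: "g \<in> borel_measurable M"
    and T_meas[measurable]: "\<And>f. f \<in> borel_measurable M \<Longrightarrow> T f \<in> borel_measurable M"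
    and T_mono: "\<And>f h x. (\<And>y. y \<in> space M \<Longrightarrow> f y \<le> h y) \<Longrightarrow> x \<in> space M \<Longrightarrow> T f x \<le> T h x"
    and T_const: "\<And>f c x. f \<in> borel_measurable M \<Longrightarrow> x \<in> space M \<Longrightarrow> T (\<lambda>y. f y + c) x \<le> T f x + c"
    and T_contr: "\<And>f. f \<in> borel_measurable M \<Longrightarrow> (\<integral>\<^sup>+x. T f x \<partial>M) \<le> (\<integral>\<^sup>+x. f x \<partial>M)"
  shows "l * emeasure M {x\<in>space M. \<exists>n. of_nat n * l < ergodic_sum T g n x} \<le> (\<integral>\<^sup>+x. g x \<partial>M)"
proof (cases "(\<integral>\<^sup>+x. g x \<partial>M) = \<infinity>")
  case False
  let ?S = "ergodic_sum T g"
  have S_meas[measurable]: "?S n \<in> borel_measurable M" for n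
    by (induction n) (auto intro!: borel_measurable_add T_meas)
  let ?A = "\<lambda>N. {x\<in>space M. \<exists>n\<le>N. of_nat n * l < ?S n x}"
  have A[measurable]: "?A N \<in> sets M" for N by measurable
  have bound: "l * emeasure M (?A N) \<le> (\<integral>\<^sup>+x. g x \<partial>M)" for N
  proof -
    let ?h = "\<lambda>x. l * indicator (?A N) x"
    let ?M = "truncated_sum T g ?h"
    have M_meas[measurable]: "?M n \<in> borel_measurable M" for n
      by (induction n) (auto intro!: borel_measurable_add borel_measurable_minus_ennreal T_meas)
    have M_Suc: "?M n x \<le> ?M (Suc n) x" if "x \<in> space M" for n x
      using that
    proof (induction n arbitrary: x)
      case (Suc n)
      then show ?case
        by (auto intro!: ennreal_minus_mono add_left_mono T_mono simp del: truncated_sum.simps(2) simp: truncated_sum.simps(2)[of T g ?h n] truncated_sum.simps(2)[of T g ?h "Suc n"])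
    qed simp
    have M_mono: "?M n x \<le> ?M m x" if "n \<le> m" "x \<in> space M" for n m x
      using that by (induction rule: dec_induct) (auto intro: order_trans M_Suc simp del: truncated_sum.simps)
    have S_le: "?S n x \<le> ?M n x + of_nat n * l" if "x \<in> space M" for n x
      using that
    proof (induction n arbitrary: x)
      case (Suc n)
      have "?S (Suc n) x \<le> g x + T (\<lambda>y. ?M n y + of_nat n * l) x"
        using Suc by (auto intro!: add_left_mono T_mono)
      also have "\<dots> \<le> g x + (T (?M n) x + of_nat n * l)"
        using Suc.prems by (intro add_left_mono T_const M_meas)
      also have "\<dots> = (g x + T (?M n) x) + of_nat n * l" by (simp add: add_ac)
      also have "\<dots> \<le> (?M (Suc n) x + l) + of_nat n * l"
      proof (intro add_right_mono)
        have "g x + T (?M n) x \<le> ((g x + T (?M n) x) - ?h x) + ?h x"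
          by (cases "?h x \<le> g x + T (?M n) x") (auto simp: diff_add_cancel_ennreal not_le intro: add_increasing less_imp_le)
        also have "\<dots> \<le> ?M (Suc n) x + l"
          by (auto intro!: add_mono simp: indicator_def)
        finally show "g x + T (?M n) x \<le> ?M (Suc n) x + l" .
      qed
      also have "\<dots> = ?M (Suc n) x + of_nat (Suc n) * l" by (simp add: algebra_simps)
      finally show ?case .
    qed simp
    have ptw: "?M (Suc N) x + ?h x \<le> g x + T (?M N) x" if x: "x \<in> space M" for x
    proof (cases "x \<in> ?A N")
      case True
      then obtain n where n: "n \<le> N" "of_nat n * l < ?S n x" by auto
      have "of_nat n * l < ?M n x + of_nat n * l" using n(2) S_le[OF x, of n] by (rule less_le_trans)
      then have "0 < ?M n x" unfolding zero_less_iff_neq_zero by (intro notI) simp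
      also have "?M n x \<le> ?M (Suc N) x" using n x by (intro M_mono) auto
      finally have pos: "0 < ?M (Suc N) x" .
      have "?h x \<le> g x + T (?M N) x"
      proof (rule ccontr)
        assume "\<not> ?thesis"
        then have "g x + T (?M N) x < ?h x" by simp
        then have "(g x + T (?M N) x) - ?h x = 0"
          by (intro diff_eq_0_ennreal) (auto simp: less_top[symmetric] dest: order.strict_trans2 intro: less_imp_le)
        with pos show False by simp
      qed
      then show ?thesis by (simp add: diff_add_cancel_ennreal)
    qed (simp add: diff_le_self_ennreal)
    \<comment> \<open>finiteness is what permits the cancellation at the end\<close>
    have M_fin: "(\<integral>\<^sup>+x. ?M n x \<partial>M) \<le> of_nat n * (\<integral>\<^sup>+x. g x \<partial>M)" for n
    proof (induction n)
      case (Suc n)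
      have "(\<integral>\<^sup>+x. ?M (Suc n) x \<partial>M) \<le> (\<integral>\<^sup>+x. g x + T (?M n) x \<partial>M)"
        by (intro nn_integral_mono) (auto simp: diff_le_self_ennreal)
      also have "\<dots> = (\<integral>\<^sup>+x. g x \<partial>M) + (\<integral>\<^sup>+x. T (?M n) x \<partial>M)"
        by (intro nn_integral_add) measurable
      also have "\<dots> \<le> (\<integral>\<^sup>+x. g x \<partial>M) + of_nat n * (\<integral>\<^sup>+x. g x \<partial>M)"
        using T_contr[OF M_meas] Suc by (intro add_left_mono) (rule order_trans)
      finally show ?case by (simp add: algebra_simps)
    qed simp
    have fin: "(\<integral>\<^sup>+x. ?M (Suc N) x \<partial>M) \<noteq> \<infinity>"
      using M_fin[of "Suc N"] False
      by (auto simp: ennreal_mult_eq_top_iff top_unique simp del: truncated_sum.simps of_nat_Suc)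
    have "(\<integral>\<^sup>+x. ?M (Suc N) x \<partial>M) + l * emeasure M (?A N) = (\<integral>\<^sup>+x. ?M (Suc N) x + ?h x \<partial>M)"
      by (subst nn_integral_add) (auto simp: nn_integral_cmult_indicator simp del: truncated_sum.simps)
    also have "\<dots> \<le> (\<integral>\<^sup>+x. g x + T (?M N) x \<partial>M)"
      by (intro nn_integral_mono ptw)
    also have "\<dots> = (\<integral>\<^sup>+x. g x \<partial>M) + (\<integral>\<^sup>+x. T (?M N) x \<partial>M)"
      by (intro nn_integral_add) measurable
    also have "\<dots> \<le> (\<integral>\<^sup>+x. g x \<partial>M) + (\<integral>\<^sup>+x. ?M (Suc N) x \<partial>M)"
    proof (intro add_left_mono order_trans[OF T_contr[OF M_meas]] nn_integral_mono)
      show "?M N x \<le> ?M (Suc N) x" if "x \<in> space M" for x using that by (rule M_Suc)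
    qed
    also have "\<dots> = (\<integral>\<^sup>+x. ?M (Suc N) x \<partial>M) + (\<integral>\<^sup>+x. g x \<partial>M)" by (rule add.commute)
    finally show ?thesis
      using fin by (simp only: ennreal_add_left_cancel_le) simp
  qed
  have "{x\<in>space M. \<exists>n. of_nat n * l < ?S n x} = (\<Union>N. ?A N)" by auto
  then have "emeasure M {x\<in>space M. \<exists>n. of_nat n * l < ?S n x} = (SUP N. emeasure M (?A N))"
  proof (simp only:, intro SUP_emeasure_incseq[symmetric])
    show "range ?A \<subseteq> sets M" using A by blast
    show "incseq ?A" by (auto simp: incseq_def intro: order_trans)
  qed
  then have "l * emeasure M {x\<in>space M. \<exists>n. of_nat n * l < ?S n x} = (SUP N. l * emeasure M (?A N))"
    by (simp add: SUP_mult_left_ennreal)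
  then show ?thesis using bound by (simp add: SUP_le_iff)
qed simp

section \<open>Maximal functions of symmetric sub-Markovian semigroups\<close>

locale symmetric_submarkov_semigroup = sigma_finite_measure M
  for M :: "'a measure" +
  fixes K :: "real \<Rightarrow> 'a \<Rightarrow> 'a \<Rightarrow> ennreal"
  assumes measurable_kernel: "t > 0 \<Longrightarrow> (\<lambda>(x, y). K t x y) \<in> borel_measurable (M \<Otimes>\<^sub>M M)"
    and symmetric: "t > 0 \<Longrightarrow> x \<in> space M \<Longrightarrow> y \<in> space M \<Longrightarrow> K t x y = K t y x"
    and submarkov: "t > 0 \<Longrightarrow> x \<in> space M \<Longrightarrow> (\<integral>\<^sup>+y. K t x y \<partial>M) \<le> 1"
    and semigroup: "t > 0 \<Longrightarrow> s > 0 \<Longrightarrow> x \<in> space M \<Longrightarrow> z \<in> space M \<Longrightarrow>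
        (\<integral>\<^sup>+y. K t x y * K s y z \<partial>M) = K (t + s) x z"
begin

definition kernel_op :: "real \<Rightarrow> ('a \<Rightarrow> ennreal) \<Rightarrow> 'a \<Rightarrow> ennreal" where
  "kernel_op t f x = (\<integral>\<^sup>+y. K t x y * f y \<partial>M)"

lemma measurable_kernel_pair:
  assumes "t > 0" "f \<in> measurable N M" "g \<in> measurable N M"
  shows "(\<lambda>x. K t (f x) (g x)) \<in> borel_measurable N"
  using measurable_compose[OF measurable_Pair[OF assms(2,3)] measurable_kernel[OF assms(1)]] by simp

lemma measurable_kernel_op:
  assumes t: "t > 0" and [measurable]: "f \<in> borel_measurable M"
  shows "kernel_op t f \<in> borel_measurable M"
proof -
  have [measurable]: "(\<lambda>(x, y). K t x y) \<in> borel_measurable (M \<Otimes>\<^sub>M M)"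
    by (rule measurable_kernel[OF t])
  show ?thesis unfolding kernel_op_def[abs_def] by measurable
qed

lemma kernel_op_add:
  assumes t: "t > 0" and [measurable]: "f \<in> borel_measurable M" "g \<in> borel_measurable M" and x: "x \<in> space M"
  shows "kernel_op t (\<lambda>y. f y + g y) x = kernel_op t f x + kernel_op t g x"
proof -
  have [measurable]: "(\<lambda>y. K t x y) \<in> borel_measurable M"
    using x by (intro measurable_kernel_pair t) auto
  show ?thesis unfolding kernel_op_def by (simp add: distrib_left nn_integral_add)
qed

lemma kernel_op_mono:
  "(\<And>y. y \<in> space M \<Longrightarrow> f y \<le> g y) \<Longrightarrow> kernel_op t f x \<le> kernel_op t g x"
  unfolding kernel_op_def by (intro nn_integral_mono mult_left_mono) auto

lemma kernel_op_const_le: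
  assumes t: "t > 0" and x: "x \<in> space M"
  shows "kernel_op t (\<lambda>_. c) x \<le> c"
proof -
  have [measurable]: "(\<lambda>y. K t x y) \<in> borel_measurable M"
    using x by (intro measurable_kernel_pair t) auto
  have "kernel_op t (\<lambda>_. c) x = (\<integral>\<^sup>+y. K t x y \<partial>M) * c"
    unfolding kernel_op_def by (rule nn_integral_multc) measurable
  also have "\<dots> \<le> 1 * c" by (intro mult_right_mono submarkov t x) simp
  finally show ?thesis by simp
qed

text \<open>
  By symmetry the operator is its own transpose, so the bound on constants turns into a bound in \<open>L\<^sup>1\<close>.
\<close>

lemma kernel_op_contraction:
  assumes t: "t > 0" and [measurable]: "f \<in> borel_measurable M"
  shows "(\<integral>\<^sup>+x. kernel_op t f x \<partial>M) \<le> (\<integral>\<^sup>+x. f x \<partial>M)"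
proof -
  interpret pair_sigma_finite M M ..
  have K[measurable]: "(\<lambda>(x, y). K t x y) \<in> borel_measurable (M \<Otimes>\<^sub>M M)"
    by (rule measurable_kernel[OF t])
  have "(\<integral>\<^sup>+x. kernel_op t f x \<partial>M) = (\<integral>\<^sup>+y. (\<integral>\<^sup>+x. K t x y * f y \<partial>M) \<partial>M)"
    unfolding kernel_op_def by (rule Fubini') measurable
  also have "\<dots> = (\<integral>\<^sup>+y. kernel_op t (\<lambda>_. f y) y \<partial>M)"
    unfolding kernel_op_def by (intro nn_integral_cong) (simp add: symmetric[OF t])
  also have "\<dots> \<le> (\<integral>\<^sup>+y. f y \<partial>M)"
    by (intro nn_integral_mono kernel_op_const_le t)
  finally show ?thesis .
qed

lemma kernel_op_semigroup:
  assumes t: "t > 0" and s: "s > 0" and [measurable]: "f \<in> borel_measurable M" and x: "x \<in> space M"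
  shows "kernel_op t (kernel_op s f) x = kernel_op (t + s) f x"
proof -
  interpret pair_sigma_finite M M ..
  have [measurable]: "(\<lambda>(x, y). K s x y) \<in> borel_measurable (M \<Otimes>\<^sub>M M)"
    by (rule measurable_kernel[OF s])
  have [measurable]: "(\<lambda>y. K t x y) \<in> borel_measurable M"
    using x by (intro measurable_kernel_pair t) auto
  have [measurable]: "y \<in> space M \<Longrightarrow> (\<lambda>z. K s y z) \<in> borel_measurable M" for y
    by (intro measurable_kernel_pair s) auto
  have [measurable]: "z \<in> space M \<Longrightarrow> (\<lambda>y. K s y z) \<in> borel_measurable M" for z
    by (intro measurable_kernel_pair s) auto
  have "kernel_op t (kernel_op s f) x = (\<integral>\<^sup>+y. (\<integral>\<^sup>+z. K t x y * (K s y z * f z) \<partial>M) \<partial>M)"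
    unfolding kernel_op_def by (intro nn_integral_cong nn_integral_cmult[symmetric]) measurable
  also have "\<dots> = (\<integral>\<^sup>+z. (\<integral>\<^sup>+y. K t x y * (K s y z * f z) \<partial>M) \<partial>M)"
    by (rule Fubini') measurable
  also have "\<dots> = (\<integral>\<^sup>+z. (\<integral>\<^sup>+y. K t x y * K s y z \<partial>M) * f z \<partial>M)"
    by (intro nn_integral_cong) (simp add: nn_integral_multc[symmetric] mult.assoc)
  also have "\<dots> = kernel_op (t + s) f x"
    unfolding kernel_op_def by (intro nn_integral_cong) (simp add: semigroup[OF t s x])
  finally show ?thesis .
qed

lemma ergodic_sum_kernel_op:
  assumes d: "d > 0" and g[measurable]: "g \<in> borel_measurable M" and x: "x \<in> space M"
  shows "ergodic_sum (kernel_op d) g (Suc n) x = g x + (\<Sum>k=1..n. kernel_op (real k * d) g x)"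
  using x
proof (induction n arbitrary: x)
  case 0
  have "kernel_op d (\<lambda>x. 0) x = 0" unfolding kernel_op_def by simp
  then show ?case by simp
next
  case (Suc n)
  have [measurable]: "kernel_op (real k * d) g \<in> borel_measurable M" if "k \<ge> 1" for k
    using that d by (intro measurable_kernel_op g) auto
  have "kernel_op d (\<lambda>y. g y + (\<Sum>k\<in>F. kernel_op (real k * d) g y)) x = kernel_op d g x + (\<Sum>k\<in>F. kernel_op (real (Suc k) * d) g x)"
    if "finite F" "F \<subseteq> {1..}" for F
    using that
  proof (induction F rule: finite_induct)
    case (insert k F)
    have k: "k \<ge> 1" "real k * d > 0" using insert d by auto
    have [measurable]: "(\<lambda>y. g y + (\<Sum>k\<in>F. kernel_op (real k * d) g y)) \<in> borel_measurable M"
      using insert.prems by (intro borel_measurable_add borel_measurable_sum g measurable_kernel_op) (use d in auto)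
    have "kernel_op d (\<lambda>y. g y + (\<Sum>k\<in>insert k F. kernel_op (real k * d) g y)) x
       = kernel_op d (\<lambda>y. (g y + (\<Sum>k\<in>F. kernel_op (real k * d) g y)) + kernel_op (real k * d) g y) x"
      using insert by (simp add: add_ac)
    also have "\<dots> = kernel_op d (\<lambda>y. g y + (\<Sum>k\<in>F. kernel_op (real k * d) g y)) x + kernel_op d (kernel_op (real k * d) g) x"
      using k by (intro kernel_op_add d Suc.prems) auto
    also have "kernel_op d (kernel_op (real k * d) g) x = kernel_op (real (Suc k) * d) g x"
      using kernel_op_semigroup[OF d k(2) g Suc.prems] by (simp add: algebra_simps)
    finally show ?case using insert by (simp add: add_ac)
  qed simp
  from this[of "{1..n}"]
  have "kernel_op d (\<lambda>y. g y + (\<Sum>k=1..n. kernel_op (real k * d) g y)) x = kernel_op d g x + (\<Sum>k=1..n. kernel_op (real (Suc k) * d) g x)"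
    by simp
  also have "\<dots> = (\<Sum>k=1..Suc n. kernel_op (real k * d) g x)"
  proof -
    have "(\<Sum>k=1..Suc n. f k) = f 1 + (\<Sum>k=1..n. f (Suc k))" for f :: "nat \<Rightarrow> ennreal"
      by (induction n) (auto simp: add_ac)
    from this[of "\<lambda>k. kernel_op (real k * d) g x"] show ?thesis by simp
  qed
  finally have "kernel_op d (\<lambda>y. g y + (\<Sum>k=1..n. kernel_op (real k * d) g y)) x = \<dots>" .
  moreover have "kernel_op d (ergodic_sum (kernel_op d) g (Suc n)) x = kernel_op d (\<lambda>y. g y + (\<Sum>k=1..n. kernel_op (real k * d) g y)) x"
    using Suc.IH by (intro antisym kernel_op_mono) (simp_all del: ergodic_sum.simps)
  ultimately show ?case by (subst ergodic_sum.simps(2)) (simp del: ergodic_sum.simps)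
qed

text \<open>
  Given \<open>t \<ge> d\<close>, choose \<open>m\<close> with \<open>t \<le> m d \<le> 2 t\<close>.  Every time \<open>k d\<close> with \<open>m \<le> k < 2 m\<close> lies in \<open>[t, 4 t]\<close>, so
  the \<open>m\<close> corresponding terms of the ergodic sum of length \<open>2 m\<close> are each at least \<open>1/C\<close> times the operator at time
  \<open>t\<close>.  A value above \<open>l\<close> at time \<open>t\<close> thus forces an ergodic average above \<open>l / (2 C)\<close>.  The bound does not
  depend on \<open>d\<close>.
\<close>

proposition weak_type_away_from_zero:
  fixes C l :: real
  assumes C: "C > 0"
    and compare: "\<And>t s x y. 0 < t \<Longrightarrow> t \<le> s \<Longrightarrow> s \<le> 4 * t \<Longrightarrow> x \<in> space M \<Longrightarrow> y \<in> space M \<Longrightarrow>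
        K t x y \<le> ennreal C * K s x y"
    and g[measurable]: "g \<in> borel_measurable M" and l: "l > 0" and d: "d > 0"
    and B: "\<And>x. x \<in> B \<Longrightarrow> x \<in> space M \<and> (\<exists>t\<ge>d. ennreal l < kernel_op t g x)"
  shows "ennreal l * emeasure M B \<le> ennreal (2 * C) * (\<integral>\<^sup>+x. g x \<partial>M)"
proof -
  define k where "k = ennreal (l / (2 * C))"
  let ?E = "{x\<in>space M. \<exists>n. of_nat n * k < ergodic_sum (kernel_op d) g n x}"
  have S_meas[measurable]: "ergodic_sum (kernel_op d) g n \<in> borel_measurable M" for n
    by (induction n) (auto intro!: borel_measurable_add measurable_kernel_op g d)
  have kernel_op_compare: "kernel_op t g x \<le> ennreal C * kernel_op s g x" if "0 < t" "t \<le> s" "s \<le> 4 * t" "x \<in> space M" for t s x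
  proof -
    have s: "s > 0" using that by simp
    have [measurable]: "(\<lambda>y. K s x y) \<in> borel_measurable M"
      using that by (intro measurable_kernel_pair s) auto
    have "kernel_op t g x \<le> (\<integral>\<^sup>+y. ennreal C * (K s x y * g y) \<partial>M)"
      unfolding kernel_op_def mult.assoc[symmetric]
      by (intro nn_integral_mono mult_right_mono compare that) auto
    also have "\<dots> = ennreal C * kernel_op s g x"
      unfolding kernel_op_def by (rule nn_integral_cmult) measurable
    finally show ?thesis .
  qed
  have "B \<subseteq> ?E"
  proof
    fix x assume "x \<in> B"
    then obtain t where x: "x \<in> space M" and t: "t \<ge> d" "ennreal l < kernel_op t g x" using B by blast
    define m where "m = nat \<lceil>t / d\<rceil>"
    have td: "t / d \<ge> 1" using t d by simp
    have m: "t / d \<le> real m" "real m \<le> 2 * (t / d)" "m \<ge> 1"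
      using td unfolding m_def by linarith+
    have m': "t \<le> real m * d" "real m * d \<le> 2 * t" using m d by (auto simp: field_simps)
    have "ergodic_sum (kernel_op d) g (2 * m) x = ergodic_sum (kernel_op d) g (Suc (2 * m - 1)) x"
      using m(3) by simp
    also have "\<dots> = g x + (\<Sum>k=1..2 * m - 1. kernel_op (real k * d) g x)"
      by (rule ergodic_sum_kernel_op[OF d g x])
    also have "\<dots> \<ge> (\<Sum>k=m..<2 * m. kernel_op (real k * d) g x)"
      using m(3) by (intro add_increasing sum_mono2) auto
    finally have "ennreal C * (\<Sum>k=m..<2 * m. kernel_op (real k * d) g x) \<le> ennreal C * ergodic_sum (kernel_op d) g (2 * m) x"
      by (intro mult_left_mono) auto
    moreover have "of_nat m * kernel_op t g x \<le> ennreal C * (\<Sum>k=m..<2 * m. kernel_op (real k * d) g x)"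
    proof -
      have "of_nat m * kernel_op t g x = (\<Sum>k=m..<2 * m. kernel_op t g x)" by simp
      also have "\<dots> \<le> (\<Sum>k=m..<2 * m. ennreal C * kernel_op (real k * d) g x)"
      proof (intro sum_mono kernel_op_compare x)
        fix j assume j: "j \<in> {m..<2 * m}"
        have "real m * d \<le> real j * d" "real j * d \<le> real (2 * m) * d"
          using j d by (auto intro!: mult_right_mono)
        then show "t \<le> real j * d" "real j * d \<le> 4 * t" using m' by auto
      qed (use t d in auto)
      finally show ?thesis by (simp add: sum_distrib_left)
    qed
    ultimately have le: "of_nat m * kernel_op t g x \<le> ennreal C * ergodic_sum (kernel_op d) g (2 * m) x" by order
    have "of_nat (2 * m) * k < ergodic_sum (kernel_op d) g (2 * m) x"
    proof (rule ccontr)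
      assume "\<not> ?thesis"
      then have "ennreal C * ergodic_sum (kernel_op d) g (2 * m) x \<le> ennreal C * (of_nat (2 * m) * k)"
        by (intro mult_left_mono) auto
      also have "\<dots> = of_nat m * ennreal l"
        unfolding k_def ennreal_of_nat_eq_real_of_nat using C l
        by (simp add: ennreal_mult'[symmetric] ennreal_mult[symmetric])
      finally have "of_nat m * kernel_op t g x \<le> of_nat m * ennreal l" using le by order
      moreover have "of_nat m * ennreal l < of_nat m * kernel_op t g x"
        using t(2) m(3) by (intro ennreal_mult_strict_left_mono) (auto simp: of_nat_less_top)
      ultimately show False by simp
    qed
    then show "x \<in> ?E" using x by blast
  qed
  then have "emeasure M B \<le> emeasure M ?E"
    by (rule emeasure_mono) measurable
  then have "ennreal l * emeasure M B \<le> ennreal (2 * C) * (k * emeasure M ?E)"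
    using C l by (simp add: k_def mult.assoc[symmetric] ennreal_mult'[symmetric] mult_left_mono)
  also have "k * emeasure M ?E \<le> (\<integral>\<^sup>+x. g x \<partial>M)"
  proof (rule maximal_ergodic_inequality)
    show "kernel_op d f x \<le> kernel_op d h x" if "\<And>y. y \<in> space M \<Longrightarrow> f y \<le> h y" for f h x
      using that by (rule kernel_op_mono)
    show "kernel_op d (\<lambda>y. f y + c) x \<le> kernel_op d f x + c" if "f \<in> borel_measurable M" "x \<in> space M" for f c x
      using kernel_op_add[OF d that(1) _ that(2), of "\<lambda>_. c"] kernel_op_const_le[OF d that(2), of c]
      by (simp add: add_left_mono)
  qed (use d in \<open>auto intro: measurable_kernel_op kernel_op_contraction\<close>)
  finally show ?thesis by (simp add: mult_left_mono)
qed

end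

section \<open>The weighted measure on the orthant\<close>

lemma pos_orthant_measurable [measurable]: "pos_orthant \<in> sets borel"
  unfolding pos_orthant_def by measurable

lemma space_eta [simp]: "space (eta \<nu>) = pos_orthant"
  by (simp add: eta_def space_restrict_space)

lemma measurable_id_eta: "(\<lambda>x. x) \<in> borel_measurable (eta \<nu>)"
  unfolding eta_def by (simp add: measurable_restrict_space1)

lemma measurable_component_eta: "(\<lambda>x. x $ i) \<in> borel_measurable (eta \<nu>)"
  by (rule measurable_compose[OF measurable_id_eta]) measurable

lemma sigma_finite_eta:
  fixes \<nu> :: "real ^ 'n"
  shows "sigma_finite_measure (eta \<nu>)"
proof -
  have "sigma_finite_measure (restrict_space lborel (pos_orthant :: (real ^ 'n) set))"
    by (intro sigma_finite_measure_restrict_space lborel.sigma_finite_measure_axioms) simp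
  moreover have "(\<lambda>x::real ^ 'n. ennreal (\<Prod>i\<in>UNIV. (x $ i) powr (2 * \<nu> $ i + 1)))
      \<in> borel_measurable (restrict_space lborel pos_orthant)"
    by (intro measurable_restrict_space1) measurable
  ultimately show ?thesis
    unfolding eta_def by (simp add: sigma_finite_measure.sigma_finite_iff_density_finite)
qed

lemma nn_integral_lborel_vec_prod:
  fixes h :: "'n::finite \<Rightarrow> real \<Rightarrow> ennreal"
  assumes [measurable]: "\<And>i. h i \<in> borel_measurable borel"
  shows "(\<integral>\<^sup>+x. (\<Prod>i\<in>UNIV. h i (x $ i)) \<partial>(lborel :: (real ^ 'n) measure)) = (\<Prod>i\<in>UNIV. (\<integral>\<^sup>+v. h i v \<partial>lborel))"
proof -
  have B: "(Basis :: (real ^ 'n) set) = range (\<lambda>i. axis i 1)" "inj (\<lambda>i. axis i 1 :: real ^ 'n)"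
    by (auto simp: Basis_vec_def inj_on_def axis_eq_axis)
  have "(\<integral>\<^sup>+x. (\<Prod>b\<in>Basis. h (axis_index b) (x \<bullet> b)) \<partial>(lborel :: (real ^ 'n) measure))
     = (\<Prod>b\<in>(Basis :: (real ^ 'n) set). (\<integral>\<^sup>+v. h (axis_index b) v \<partial>lborel))"
    by (rule nn_integral_lborel_prod) auto
  then show ?thesis
    unfolding B(1) prod.reindex[OF B(2)] by (simp add: o_def inner_axis)
qed

lemma nn_integral_eta_prod:
  fixes g :: "'n::finite \<Rightarrow> real \<Rightarrow> real"
  assumes g_meas[measurable]: "\<And>i. g i \<in> borel_measurable borel"
    and g_nonneg: "\<And>i v. v > 0 \<Longrightarrow> 0 \<le> g i v"
  shows "(\<integral>\<^sup>+x. ennreal (\<Prod>i\<in>UNIV. g i (x $ i)) \<partial>eta \<nu>)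
    = (\<Prod>i\<in>UNIV. (\<integral>\<^sup>+v\<in>{0<..}. ennreal (g i v * v powr (2 * \<nu> $ i + 1)) \<partial>lborel))"
proof -
  let ?w = "\<lambda>x::real ^ 'n. \<Prod>i\<in>UNIV. (x $ i) powr (2 * \<nu> $ i + 1)"
  have "(\<integral>\<^sup>+x. ennreal (\<Prod>i\<in>UNIV. g i (x $ i)) \<partial>eta \<nu>)
    = (\<integral>\<^sup>+x. ennreal (?w x) * ennreal (\<Prod>i\<in>UNIV. g i (x $ i)) \<partial>restrict_space lborel pos_orthant)"
    unfolding eta_def by (intro nn_integral_density measurable_restrict_space1) measurable
  also have "\<dots> = (\<integral>\<^sup>+x. ennreal (?w x) * ennreal (\<Prod>i\<in>UNIV. g i (x $ i)) * indicator pos_orthant x \<partial>lborel)"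
    by (intro nn_integral_restrict_space) simp
  also have "\<dots> = (\<integral>\<^sup>+x. (\<Prod>i\<in>UNIV. ennreal (g i (x $ i) * (x $ i) powr (2 * \<nu> $ i + 1)) * indicator {0<..} (x $ i)) \<partial>lborel)"
  proof (rule nn_integral_cong)
    fix x :: "real ^ 'n"
    show "ennreal (?w x) * ennreal (\<Prod>i\<in>UNIV. g i (x $ i)) * indicator pos_orthant x
       = (\<Prod>i\<in>UNIV. ennreal (g i (x $ i) * (x $ i) powr (2 * \<nu> $ i + 1)) * indicator {0<..} (x $ i))"
    proof (cases "x \<in> pos_orthant")
      case True
      then have x: "x $ i > 0" for i by (simp add: pos_orthant_def)
      have "(\<Prod>i\<in>UNIV. ennreal (g i (x $ i) * (x $ i) powr (2 * \<nu> $ i + 1)) * indicator {0<..} (x $ i))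
        = ennreal (\<Prod>i\<in>UNIV. g i (x $ i) * (x $ i) powr (2 * \<nu> $ i + 1))"
        using x g_nonneg by (subst prod_ennreal[symmetric]) (auto intro!: prod.cong)
      also have "\<dots> = ennreal (?w x) * ennreal (\<Prod>i\<in>UNIV. g i (x $ i))"
        unfolding prod.distrib using x g_nonneg
        by (subst ennreal_mult[symmetric]) (auto intro!: prod_nonneg simp: mult.commute)
      finally show ?thesis using True by simp
    next
      case False
      then obtain i where "\<not> x $ i > 0" by (auto simp: pos_orthant_def)
      then have "(\<Prod>i\<in>UNIV. ennreal (g i (x $ i) * (x $ i) powr (2 * \<nu> $ i + 1)) * indicator {0<..} (x $ i)) = 0"
        by (intro prod_zero bexI[of _ i]) auto
      then show ?thesis using False by simp
    qed
  qed
  also have "\<dots> = (\<Prod>i\<in>UNIV. (\<integral>\<^sup>+v\<in>{0<..}. ennreal (g i v * v powr (2 * \<nu> $ i + 1)) \<partial>lborel))"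
    by (rule nn_integral_lborel_vec_prod) measurable
  finally show ?thesis .
qed

section \<open>The mixed semigroup\<close>

locale negative_exotic_indices =
  fixes \<nu> :: "real ^ 'n" and E :: "'n set"
  assumes exotic: "i \<in> E \<Longrightarrow> \<nu> $ i < 0"
    and classical: "i \<notin> E \<Longrightarrow> \<nu> $ i > -1"
begin

text \<open>
  The exponent \<open>c\<close> and the order \<open>a\<close> that put the factor of a coordinate, exotic or classical, into the
  common form \<open>(u v)\<^sup>c W\<^sub>t\<^sup>a(u, v)\<close>.
\<close>

definition twist :: "'n \<Rightarrow> real" where "twist i = (if i \<in> E then - 2 * \<nu> $ i else 0)"
definition bessel_order :: "'n \<Rightarrow> real" where "bessel_order i = (if i \<in> E then - \<nu> $ i else \<nu> $ i)"

lemma bessel_order_gt: "bessel_order i > -1"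
  using exotic[of i] classical[of i] by (auto simp: bessel_order_def)

lemma twist_nonneg: "twist i \<ge> 0"
  using exotic[of i] by (auto simp: twist_def)

lemma twist_cases: "twist i = 0 \<or> 0 < bessel_order i \<and> twist i = 2 * bessel_order i"
  using exotic[of i] by (auto simp: twist_def bessel_order_def)

lemma weight_exponent: "2 * \<nu> $ i + 1 = 2 * bessel_order i + 1 - 2 * twist i"
  by (auto simp: twist_def bessel_order_def)

definition factor :: "'n \<Rightarrow> real \<Rightarrow> real \<Rightarrow> real \<Rightarrow> real" where
  "factor i = twisted_kernel (twist i) (bessel_order i)"

lemma mixed_kernel_eq_prod:
  assumes "x \<in> pos_orthant" "y \<in> pos_orthant"
  shows "mixed_kernel \<nu> E t x y = (\<Prod>i\<in>UNIV. factor i t (x $ i) (y $ i))"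
proof -
  have pos: "x $ i \<noteq> 0" "y $ i \<noteq> 0" for i using assms by (auto simp: pos_orthant_def less_le)
  have "(\<Prod>i\<in>UNIV. factor i t (x $ i) (y $ i))
    = (\<Prod>i\<in>E. factor i t (x $ i) (y $ i)) * (\<Prod>i\<in>-E. factor i t (x $ i) (y $ i))"
    using prod.union_disjoint[of E "-E" "\<lambda>i. factor i t (x $ i) (y $ i)"] by simp
  also have "(\<Prod>i\<in>E. factor i t (x $ i) (y $ i)) = (\<Prod>i\<in>E. exotic_bessel_kernel (\<nu> $ i) t (x $ i) (y $ i))"
    by (intro prod.cong) (auto simp: factor_def twisted_kernel_def exotic_bessel_kernel_def twist_def bessel_order_def)
  also have "(\<Prod>i\<in>-E. factor i t (x $ i) (y $ i)) = (\<Prod>i\<in>-E. bessel_kernel (\<nu> $ i) t (x $ i) (y $ i))"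
  proof (intro prod.cong refl)
    fix i assume "i \<in> - E"
    then show "factor i t (x $ i) (y $ i) = bessel_kernel (\<nu> $ i) t (x $ i) (y $ i)"
      using pos[of i] by (auto simp: factor_def twisted_kernel_def twist_def bessel_order_def)
  qed
  finally show ?thesis by (simp add: mixed_kernel_def)
qed

lemma factor_pos: "t > 0 \<Longrightarrow> u > 0 \<Longrightarrow> v > 0 \<Longrightarrow> factor i t u v > 0"
  unfolding factor_def by (intro twisted_kernel_pos bessel_order_gt)

lemma mixed_kernel_nonneg:
  assumes "t > 0" "x \<in> pos_orthant" "y \<in> pos_orthant"
  shows "0 \<le> mixed_kernel \<nu> E t x y"
  unfolding mixed_kernel_eq_prod[OF assms(2,3)]
  using assms by (auto intro!: prod_nonneg less_imp_le[OF factor_pos] simp: pos_orthant_def)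

definition doubling_const :: real where
  "doubling_const = (\<Prod>i\<in>UNIV. 16 * 4 powr (bessel_order i + 1))"

lemma doubling_const_pos: "doubling_const > 0"
  unfolding doubling_const_def by (intro prod_pos) auto

lemma mixed_kernel_compare:
  assumes "t > 0" "t \<le> s" "s \<le> 4 * t" "x \<in> pos_orthant" "y \<in> pos_orthant"
  shows "mixed_kernel \<nu> E t x y \<le> doubling_const * mixed_kernel \<nu> E s x y"
  unfolding mixed_kernel_eq_prod[OF assms(4,5)] doubling_const_def prod.distrib[symmetric]
proof (intro prod_mono conjI)
  fix i
  have p: "x $ i > 0" "y $ i > 0" using assms by (auto simp: pos_orthant_def)
  show "0 \<le> factor i t (x $ i) (y $ i)" using factor_pos[OF assms(1) p] by (rule less_imp_le)
  show "factor i t (x $ i) (y $ i) \<le> 16 * 4 powr (bessel_order i + 1) * factor i s (x $ i) (y $ i)"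
    unfolding factor_def by (intro twisted_kernel_compare bessel_order_gt assms p)
qed

text \<open>
  Because of this bound the integral against an integrable function converges at every point, not merely
  almost everywhere, and can be treated by dominated convergence at each of them.
\<close>

lemma mixed_kernel_bounded:
  assumes t: "t > 0" and x: "x \<in> pos_orthant"
  shows "\<exists>B. \<forall>y\<in>pos_orthant. mixed_kernel \<nu> E t x y \<le> B"
proof -
  have xi: "x $ i > 0" for i using x by (simp add: pos_orthant_def)
  have "\<forall>i. \<exists>B. \<forall>v>0. factor i t (x $ i) v \<le> B"
    unfolding factor_def by (intro allI twisted_kernel_bounded bessel_order_gt twist_nonneg t xi)
  then obtain B where B: "\<And>i v. v > 0 \<Longrightarrow> factor i t (x $ i) v \<le> B i" by metis
  have "mixed_kernel \<nu> E t x y \<le> (\<Prod>i\<in>UNIV. B i)" if y: "y \<in> pos_orthant" for y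
    unfolding mixed_kernel_eq_prod[OF x y]
    using y t xi by (intro prod_mono conjI B less_imp_le[OF factor_pos]) (auto simp: pos_orthant_def)
  then show ?thesis by blast
qed

lemma mixed_kernel_tendsto:
  assumes t: "t > 0" and r: "r \<longlonglongrightarrow> t" and x: "x \<in> pos_orthant" and y: "y \<in> pos_orthant"
  shows "(\<lambda>n. mixed_kernel \<nu> E (r n) x y) \<longlonglongrightarrow> mixed_kernel \<nu> E t x y"
  unfolding mixed_kernel_eq_prod[OF x y]
proof (intro tendsto_prod)
  fix i
  have "continuous_on {0<..} (\<lambda>t. factor i t (x $ i) (y $ i))"
    unfolding factor_def using x y
    by (intro continuous_on_twisted_kernel_time bessel_order_gt) (auto simp: pos_orthant_def)
  then have "isCont (\<lambda>t. factor i t (x $ i) (y $ i)) t"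
    using t by (simp add: continuous_on_eq_continuous_at)
  then show "(\<lambda>n. factor i (r n) (x $ i) (y $ i)) \<longlonglongrightarrow> factor i t (x $ i) (y $ i)"
    using r by (rule isCont_tendsto_compose)
qed

lemma measurable_mixed_kernel [measurable (raw)]:
  assumes "f \<in> measurable N (eta \<nu>)" "g \<in> measurable N (eta \<nu>)"
  shows "(\<lambda>z. mixed_kernel \<nu> E t (f z) (g z)) \<in> borel_measurable N"
proof -
  have [measurable]: "(\<lambda>z. f z $ i) \<in> borel_measurable N" "(\<lambda>z. g z $ i) \<in> borel_measurable N" for i
    using measurable_compose[OF assms(1) measurable_component_eta] measurable_compose[OF assms(2) measurable_component_eta]
    by auto
  show ?thesis
    unfolding mixed_kernel_def exotic_bessel_kernel_def bessel_kernel_def by measurable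
qed

sublocale symmetric_submarkov_semigroup "eta \<nu>" "\<lambda>t x y. ennreal (mixed_kernel \<nu> E t x y)"
proof (unfold_locales)
  show "\<exists>A. countable A \<and> A \<subseteq> sets (eta \<nu>) \<and> \<Union> A = space (eta \<nu>) \<and> (\<forall>a\<in>A. emeasure (eta \<nu>) a \<noteq> \<infinity>)"
    using sigma_finite_eta[of \<nu>] by (rule sigma_finite_measure.sigma_finite_countable)
next
  fix t :: real assume "t > 0"
  show "(\<lambda>(x, y). ennreal (mixed_kernel \<nu> E t x y)) \<in> borel_measurable (eta \<nu> \<Otimes>\<^sub>M eta \<nu>)"
    by measurable
next
  fix t :: real and x y assume "t > 0" "x \<in> space (eta \<nu>)" "y \<in> space (eta \<nu>)"
  then show "ennreal (mixed_kernel \<nu> E t x y) = ennreal (mixed_kernel \<nu> E t y x)"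
    by (simp add: mixed_kernel_eq_prod factor_def twisted_kernel_commute)
next
  fix t :: real and x assume t: "t > 0" and x: "x \<in> space (eta \<nu>)"
  then have xi: "x $ i > 0" for i by (simp add: pos_orthant_def)
  have "(\<integral>\<^sup>+y. ennreal (mixed_kernel \<nu> E t x y) \<partial>eta \<nu>) = (\<integral>\<^sup>+y. ennreal (\<Prod>i\<in>UNIV. factor i t (x $ i) (y $ i)) \<partial>eta \<nu>)"
    using x by (intro nn_integral_cong) (simp add: mixed_kernel_eq_prod)
  also have "\<dots> = (\<Prod>i\<in>UNIV. (\<integral>\<^sup>+v\<in>{0<..}. ennreal (factor i t (x $ i) v * v powr (2 * \<nu> $ i + 1)) \<partial>lborel))"
    by (rule nn_integral_eta_prod) (auto simp: factor_def intro!: less_imp_le[OF twisted_kernel_pos] bessel_order_gt t xi)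
  also have "\<dots> \<le> 1"
    unfolding weight_exponent factor_def
    using twisted_kernel_mass[OF bessel_order_gt twist_cases t xi] by (intro prod_le_1) auto
  finally show "(\<integral>\<^sup>+y. ennreal (mixed_kernel \<nu> E t x y) \<partial>eta \<nu>) \<le> 1" .
next
  fix t s :: real and x z assume t: "t > 0" and s: "s > 0" and x: "x \<in> space (eta \<nu>)" and z: "z \<in> space (eta \<nu>)"
  then have xi: "x $ i > 0" and zi: "z $ i > 0" for i by (auto simp: pos_orthant_def)
  let ?g = "\<lambda>i v. factor i t (x $ i) v * factor i s v (z $ i)"
  have "(\<integral>\<^sup>+y. ennreal (mixed_kernel \<nu> E t x y) * ennreal (mixed_kernel \<nu> E s y z) \<partial>eta \<nu>)
     = (\<integral>\<^sup>+y. ennreal (\<Prod>i\<in>UNIV. ?g i (y $ i)) \<partial>eta \<nu>)"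
  proof (intro nn_integral_cong)
    fix y assume y: "y \<in> space (eta \<nu>)"
    have "ennreal (mixed_kernel \<nu> E t x y) * ennreal (mixed_kernel \<nu> E s y z)
      = ennreal (mixed_kernel \<nu> E t x y * mixed_kernel \<nu> E s y z)"
      using mixed_kernel_nonneg t s x y z by (intro ennreal_mult[symmetric]) auto
    then show "ennreal (mixed_kernel \<nu> E t x y) * ennreal (mixed_kernel \<nu> E s y z) = ennreal (\<Prod>i\<in>UNIV. ?g i (y $ i))"
      using x y z by (simp add: mixed_kernel_eq_prod prod.distrib)
  qed
  also have "\<dots> = (\<Prod>i\<in>UNIV. (\<integral>\<^sup>+v\<in>{0<..}. ennreal (?g i v * v powr (2 * \<nu> $ i + 1)) \<partial>lborel))"
    by (rule nn_integral_eta_prod)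
       (auto simp: factor_def intro!: mult_nonneg_nonneg less_imp_le[OF twisted_kernel_pos] bessel_order_gt t s xi zi)
  also have "\<dots> = (\<Prod>i\<in>UNIV. ennreal (factor i (t + s) (x $ i) (z $ i)))"
    unfolding weight_exponent factor_def by (simp add: twisted_kernel_semigroup[OF bessel_order_gt t s xi zi])
  also have "\<dots> = ennreal (mixed_kernel \<nu> E (t + s) x z)"
    using x z t s xi zi by (simp add: mixed_kernel_eq_prod prod_ennreal less_imp_le[OF factor_pos])
  finally show "(\<integral>\<^sup>+y. ennreal (mixed_kernel \<nu> E t x y) * ennreal (mixed_kernel \<nu> E s y z) \<partial>eta \<nu>)
      = ennreal (mixed_kernel \<nu> E (t + s) x z)" .
qed

lemma integrable_mixed_kernel_mult:
  fixes f :: "real ^ 'n \<Rightarrow> complex"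
  assumes t: "t > 0" and x: "x \<in> pos_orthant" and f: "integrable (eta \<nu>) f"
  shows "integrable (eta \<nu>) (\<lambda>y. complex_of_real (mixed_kernel \<nu> E t x y) * f y)"
proof -
  obtain B where B: "\<And>y. y \<in> pos_orthant \<Longrightarrow> mixed_kernel \<nu> E t x y \<le> B"
    using mixed_kernel_bounded[OF t x] by blast
  have [measurable]: "f \<in> borel_measurable (eta \<nu>)" using f by auto
  have [measurable]: "(\<lambda>y. mixed_kernel \<nu> E t x y) \<in> borel_measurable (eta \<nu>)"
    using x by (intro measurable_mixed_kernel) auto
  show ?thesis
  proof (rule Bochner_Integration.integrable_bound)
    show "integrable (eta \<nu>) (\<lambda>y. B * norm (f y))" using f by auto
    show "AE y in eta \<nu>. norm (complex_of_real (mixed_kernel \<nu> E t x y) * f y) \<le> norm (B * norm (f y))"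
    proof (rule AE_I2)
      fix y assume "y \<in> space (eta \<nu>)"
      then have "0 \<le> mixed_kernel \<nu> E t x y" "mixed_kernel \<nu> E t x y \<le> B"
        using mixed_kernel_nonneg[OF t x] B by auto
      then show "norm (complex_of_real (mixed_kernel \<nu> E t x y) * f y) \<le> norm (B * norm (f y))"
        by (simp add: norm_mult abs_mult mult_right_mono)
    qed
  qed measurable
qed

lemma measurable_mixed_semigroup:
  fixes f :: "real ^ 'n \<Rightarrow> complex"
  assumes [measurable]: "f \<in> borel_measurable (eta \<nu>)"
  shows "mixed_semigroup \<nu> E t f \<in> borel_measurable (eta \<nu>)"
  unfolding mixed_semigroup_def[abs_def] by measurable

lemma norm_mixed_semigroup_le:
  assumes t: "t > 0" and x: "x \<in> pos_orthant" and f: "integrable (eta \<nu>) f"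
  shows "ennreal (cmod (mixed_semigroup \<nu> E t f x)) \<le> kernel_op t (\<lambda>y. ennreal (cmod (f y))) x"
proof -
  have "ennreal (cmod (mixed_semigroup \<nu> E t f x))
    \<le> (\<integral>\<^sup>+y. ennreal (cmod (complex_of_real (mixed_kernel \<nu> E t x y) * f y)) \<partial>eta \<nu>)"
    unfolding mixed_semigroup_def by (rule integral_norm_bound_ennreal[OF integrable_mixed_kernel_mult[OF assms]])
  also have "\<dots> = kernel_op t (\<lambda>y. ennreal (cmod (f y))) x"
    unfolding kernel_op_def
  proof (intro nn_integral_cong)
    fix y assume "y \<in> space (eta \<nu>)"
    then show "ennreal (cmod (complex_of_real (mixed_kernel \<nu> E t x y) * f y))
       = ennreal (mixed_kernel \<nu> E t x y) * ennreal (cmod (f y))"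
      using mixed_kernel_nonneg[OF t x, of y] by (simp add: norm_mult ennreal_mult)
  qed
  finally show ?thesis .
qed

text \<open>
  Dominated convergence: by time comparison all kernels at times in \<open>[t, 2 t]\<close> are dominated by the one at
  time \<open>2 t\<close>.
\<close>

lemma mixed_semigroup_tendsto:
  assumes t: "t > 0" and x: "x \<in> pos_orthant" and f: "integrable (eta \<nu>) f"
    and r: "r \<longlonglongrightarrow> t" and r_bounds: "\<And>n. t \<le> r n \<and> r n \<le> 2 * t"
  shows "(\<lambda>n. mixed_semigroup \<nu> E (r n) f x) \<longlonglongrightarrow> mixed_semigroup \<nu> E t f x"
  unfolding mixed_semigroup_def
proof (rule integral_dominated_convergence)
  have t2: "2 * t > 0" using t by simp
  have [measurable]: "f \<in> borel_measurable (eta \<nu>)" using f by auto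
  have [measurable]: "(\<lambda>y. mixed_kernel \<nu> E s x y) \<in> borel_measurable (eta \<nu>)" for s
    using x by (intro measurable_mixed_kernel) auto
  show "(\<lambda>y. complex_of_real (mixed_kernel \<nu> E t x y) * f y) \<in> borel_measurable (eta \<nu>)" by measurable
  show "(\<lambda>y. complex_of_real (mixed_kernel \<nu> E (r n) x y) * f y) \<in> borel_measurable (eta \<nu>)" for n by measurable
  show "integrable (eta \<nu>) (\<lambda>y. doubling_const * norm (complex_of_real (mixed_kernel \<nu> E (2 * t) x y) * f y))"
    by (intro integrable_mult_right integrable_norm integrable_mixed_kernel_mult t2 x f)
  show "AE y in eta \<nu>. (\<lambda>n. complex_of_real (mixed_kernel \<nu> E (r n) x y) * f y)
      \<longlonglongrightarrow> complex_of_real (mixed_kernel \<nu> E t x y) * f y"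
    by (rule AE_I2) (auto intro!: tendsto_intros mixed_kernel_tendsto t r x)
  show "AE y in eta \<nu>. norm (complex_of_real (mixed_kernel \<nu> E (r n) x y) * f y)
      \<le> doubling_const * norm (complex_of_real (mixed_kernel \<nu> E (2 * t) x y) * f y)" for n
  proof (rule AE_I2)
    fix y assume "y \<in> space (eta \<nu>)"
    then have y: "y \<in> pos_orthant" by simp
    have rn: "r n > 0" "r n \<le> 2 * t" "2 * t \<le> 4 * r n" using r_bounds[of n] t by auto
    show "norm (complex_of_real (mixed_kernel \<nu> E (r n) x y) * f y)
      \<le> doubling_const * norm (complex_of_real (mixed_kernel \<nu> E (2 * t) x y) * f y)"
      using mixed_kernel_compare[OF rn x y] mixed_kernel_nonneg[OF rn(1) x y] mixed_kernel_nonneg[OF t2 x y]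
      by (simp add: norm_mult mult.assoc[symmetric] mult_right_mono)
  qed
qed

lemma exists_rational_time:
  assumes t: "t > 0" and x: "x \<in> pos_orthant" and f: "integrable (eta \<nu>) f"
    and s: "s < cmod (mixed_semigroup \<nu> E t f x)"
  shows "\<exists>r\<in>\<rat>. 0 < r \<and> s < cmod (mixed_semigroup \<nu> E r f x)"
proof -
  have "\<forall>n. \<exists>q\<in>\<rat>. t < q \<and> q < t + t / real (Suc n)"
    using t by (intro allI Rats_dense_in_real) simp
  then obtain r where r: "\<And>n. r n \<in> \<rat>" "\<And>n. t < r n" "\<And>n. r n < t + t / real (Suc n)" by metis
  have "(\<lambda>n. t + t * inverse (real (Suc n))) \<longlonglongrightarrow> t + t * 0"
    by (intro tendsto_intros LIMSEQ_inverse_real_of_nat)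
  then have "r \<longlonglongrightarrow> t"
    using r(2,3) by (intro tendsto_sandwich[of "\<lambda>_. t" r sequentially "\<lambda>n. t + t * inverse (real (Suc n))"])
      (auto intro!: always_eventually less_imp_le simp: divide_inverse)
  moreover have "r n \<le> 2 * t" for n
  proof -
    have "t / real (Suc n) \<le> t / 1" using t by (intro divide_left_mono) auto
    then show ?thesis using r(3)[of n] by simp
  qed
  ultimately have "(\<lambda>n. cmod (mixed_semigroup \<nu> E (r n) f x)) \<longlonglongrightarrow> cmod (mixed_semigroup \<nu> E t f x)"
    using r(2) by (intro tendsto_norm mixed_semigroup_tendsto t x f) (auto intro: less_imp_le)
  then have "eventually (\<lambda>n. s < cmod (mixed_semigroup \<nu> E (r n) f x)) sequentially"
    using s by (rule order_tendstoD)
  then obtain n where "s < cmod (mixed_semigroup \<nu> E (r n) f x)"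
    by (auto simp: eventually_sequentially)
  then show ?thesis using r(1,2)[of n] t by (intro bexI[of _ "r n"]) auto
qed

text \<open>
  The level set is the increasing union of the sets \<open>?B n\<close>, in which only rational times
  \<open>\<ge> 1 / (n + 1)\<close> are taken into account.  Each is a countable union of measurable sets, and
  \<open>weak_type_away_from_zero\<close> bounds their measures uniformly in \<open>n\<close>.
\<close>

theorem maximal_op_weak_type:
  assumes f: "integrable (eta \<nu>) f" and s: "s > 0"
  shows "{x \<in> pos_orthant. ennreal s < maximal_op \<nu> E f x} \<in> sets (eta \<nu>)"
    and "emeasure (eta \<nu>) {x \<in> pos_orthant. ennreal s < maximal_op \<nu> E f x}
       \<le> ennreal (2 * doubling_const / s * (LINT x | eta \<nu>. cmod (f x)))"
proof -
  let ?W = "\<lambda>t x. cmod (mixed_semigroup \<nu> E t f x)"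
  let ?B = "\<lambda>n. {x \<in> space (eta \<nu>). \<exists>r\<in>\<rat> \<inter> {1 / real (Suc n)..}. s < ?W r x}"
  have f_meas[measurable]: "f \<in> borel_measurable (eta \<nu>)" using f by auto
  have [measurable]: "mixed_semigroup \<nu> E t f \<in> borel_measurable (eta \<nu>)" for t
    by (rule measurable_mixed_semigroup) measurable
  have B_meas: "?B n \<in> sets (eta \<nu>)" for n
  proof -
    have "?B n = (\<Union>r\<in>\<rat> \<inter> {1 / real (Suc n)..}. {x \<in> space (eta \<nu>). s < ?W r x})" by auto
    also have "\<dots> \<in> sets (eta \<nu>)"
      by (intro sets.countable_UN'' countable_Int1 countable_rat) measurable
    finally show ?thesis .
  qed
  have eq: "{x \<in> pos_orthant. ennreal s < maximal_op \<nu> E f x} = (\<Union>n. ?B n)"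
  proof (intro set_eqI iffI)
    fix x assume "x \<in> {x \<in> pos_orthant. ennreal s < maximal_op \<nu> E f x}"
    then obtain t where t: "t > 0" "x \<in> pos_orthant" "s < ?W t x"
      using s by (auto simp: maximal_op_def less_SUP_iff ennreal_less_iff)
    then obtain r where r: "r \<in> \<rat>" "0 < r" "s < ?W r x"
      using exists_rational_time[OF t(1,2) f t(3)] by blast
    obtain n where "1 / real (Suc n) < r" using nat_approx_posE[OF r(2)] by blast
    then have "x \<in> ?B n" using t(2) r by (auto simp del: of_nat_Suc intro!: bexI[of _ r])
    then show "x \<in> (\<Union>n. ?B n)" by blast
  next
    fix x assume "x \<in> (\<Union>n. ?B n)"
    then obtain n r where r: "1 / real (Suc n) \<le> r" "x \<in> pos_orthant" "s < ?W r x" by auto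
    have "0 < 1 / real (Suc n)" by simp
    then have "r > 0" using r(1) by linarith
    then show "x \<in> {x \<in> pos_orthant. ennreal s < maximal_op \<nu> E f x}"
      using r s by (auto simp: maximal_op_def less_SUP_iff ennreal_less_iff)
  qed
  show "{x \<in> pos_orthant. ennreal s < maximal_op \<nu> E f x} \<in> sets (eta \<nu>)"
    unfolding eq using B_meas by blast
  let ?I = "LINT x | eta \<nu>. cmod (f x)"
  have B_le: "emeasure (eta \<nu>) (?B n) \<le> ennreal (2 * doubling_const / s * ?I)" for n
  proof -
    have "ennreal s * emeasure (eta \<nu>) (?B n) \<le> ennreal (2 * doubling_const) * (\<integral>\<^sup>+x. ennreal (cmod (f x)) \<partial>eta \<nu>)"
    proof (rule weak_type_away_from_zero[where d = "1 / real (Suc n)"])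
      show "ennreal (mixed_kernel \<nu> E t x y) \<le> ennreal doubling_const * ennreal (mixed_kernel \<nu> E t' x y)"
        if "0 < t" "t \<le> t'" "t' \<le> 4 * t" "x \<in> space (eta \<nu>)" "y \<in> space (eta \<nu>)" for t t' x y
        using mixed_kernel_compare[of t t' x y] that doubling_const_pos
        by (simp add: ennreal_mult'[symmetric] ennreal_leI)
      show "x \<in> space (eta \<nu>) \<and> (\<exists>t\<ge>1 / real (Suc n). ennreal s < kernel_op t (\<lambda>x. ennreal (cmod (f x))) x)"
        if x: "x \<in> ?B n" for x
      proof -
        obtain r where r: "1 / real (Suc n) \<le> r" "x \<in> pos_orthant" "s < ?W r x" using x by auto
        have "0 < 1 / real (Suc n)" by simp
        then have "r > 0" using r(1) by linarith
        have "ennreal s < ennreal (?W r x)" using r(3) s by (simp add: ennreal_less_iff)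
        also have "\<dots> \<le> kernel_op r (\<lambda>x. ennreal (cmod (f x))) x"
          by (rule norm_mixed_semigroup_le[OF \<open>r > 0\<close> r(2) f])
        finally show ?thesis using r by auto
      qed
    qed (use s doubling_const_pos in auto)
    also have "(\<integral>\<^sup>+x. ennreal (cmod (f x)) \<partial>eta \<nu>) = ennreal ?I"
      using f by (intro nn_integral_eq_integral) auto
    finally have le: "ennreal s * emeasure (eta \<nu>) (?B n) \<le> ennreal (2 * doubling_const) * ennreal ?I" .
    have "emeasure (eta \<nu>) (?B n) = ennreal (1 / s) * (ennreal s * emeasure (eta \<nu>) (?B n))"
      using s by (simp add: mult.assoc[symmetric] ennreal_mult'[symmetric])
    also have "\<dots> \<le> ennreal (1 / s) * (ennreal (2 * doubling_const) * ennreal ?I)"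
      using le by (rule mult_left_mono) simp
    also have "\<dots> = ennreal (2 * doubling_const / s * ?I)"
      using s doubling_const_pos by (simp add: ennreal_mult[symmetric] integral_nonneg_AE)
    finally show ?thesis .
  qed
  have "incseq ?B"
  proof (intro incseq_SucI subsetI)
    fix n x assume "x \<in> ?B n"
    moreover have "1 / real (Suc (Suc n)) \<le> 1 / real (Suc n)" by (intro divide_left_mono) auto
    ultimately show "x \<in> ?B (Suc n)" by (auto simp del: of_nat_Suc intro: order_trans)
  qed
  then have "emeasure (eta \<nu>) (\<Union>n. ?B n) = (SUP n. emeasure (eta \<nu>) (?B n))"
    using B_meas by (intro SUP_emeasure_incseq[symmetric]) auto
  also have "\<dots> \<le> ennreal (2 * doubling_const / s * ?I)"
    by (intro SUP_least B_le)
  finally show "emeasure (eta \<nu>) {x \<in> pos_orthant. ennreal s < maximal_op \<nu> E f x}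
       \<le> ennreal (2 * doubling_const / s * ?I)"
    unfolding eq .
qed

end

lemma negative_exotic_indicesI:
  assumes "\<nu> \<in> admissible E" and "max_index E \<nu> < 0"
  shows "negative_exotic_indices \<nu> E"
proof
  fix i
  show "\<nu> $ i < 0" if i: "i \<in> E"
  proof -
    have "\<nu> $ i \<le> Max ((\<lambda>i. \<nu> $ i) ` E)" using i by (intro Max_ge) auto
    also have "\<dots> < 0" using assms(2) i by (auto simp: max_index_def zero_ereal_def split: if_splits)
    finally show ?thesis .
  qed
  show "\<nu> $ i > -1" if "i \<notin> E" using assms(1) that by (auto simp: admissible_def)
qed

theorem theorem4p1:
  fixes \<nu> :: "real ^ 'n" and E :: "'n set"
  assumes "\<nu> \<in> admissible E"
    and "max_index E \<nu> < 0"
  shows "\<exists>C::real. 0 \<le> C \<and>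
           (\<forall>f :: real ^ 'n \<Rightarrow> complex. integrable (eta \<nu>) f \<longrightarrow>
             (\<forall>s>0::real.
               {x \<in> pos_orthant. ennreal s < maximal_op \<nu> E f x} \<in> sets (eta \<nu>) \<and>
               emeasure (eta \<nu>) {x \<in> pos_orthant. ennreal s < maximal_op \<nu> E f x}
                 \<le> ennreal (C / s * (LINT x | eta \<nu>. cmod (f x)))))"
proof -
  interpret negative_exotic_indices \<nu> E
    using assms by (rule negative_exotic_indicesI)
  show ?thesis
    using maximal_op_weak_type doubling_const_pos
    by (intro exI[of _ "2 * doubling_const"]) auto
qed

end
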